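(* Let $\mathcal{D}=(G,\chi,a,\alpha)$ be a datum, let $n>1$ be the order of $\chi(a)$, and let $\mathcal{H}=(H_{\mathcal{D}},\cdot,\mathbin{:})$ be a Hopf $q$-brace structure on $H_{\mathcal{D}}$ such that $x\cdot x=x\mathbin{:}x=0$. Let $\lambda,\xi\colon G\to\mathds{k}^{\times}$ be the characters such that $x\cdot g=\lambda(g)x$ and $x\mathbin{:}g=\xi(g)x$ for all $g\in G$, and let $L:=\{h\in\mathrm{Soc}(G,\cdot,\mathbin{:}):\lambda(h)=\xi(h)=1\}$. Then $$\mathrm{Soc}(\mathcal{H})=\begin{cases}\mathds{k}[L]\oplus\mathds{k}[L]x\oplus\cdots\oplus\mathds{k}[L]x^{n-1}&\text{if }\lambda(a)=1,\\ \mathds{k}[L]&\text{if }\lambda(a)\ne1.\end{cases}$$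
   Context: $\mathds{k}$ is an algebraically closed field of characteristic zero, $\mathbb{N}_0=\{0,1,2,\dots\}$. Sweedler notation is used. Multiplication has precedence over the binary operations $\cdot$ and $\mathbin{:}$, which have precedence over $+$ and $-$. Rank one pointed Hopf algebras. A datum $\mathcal{D}=(G,\chi,a,\alpha)$ consists of a finite group $G$, a character $\chi\colon G\to\mathds{k}^{\times}$, a central element $a\in G$ and $\alpha\in\mathds{k}$ such that, denoting by $n$ the order of $\chi(a)$, one has $n>1$ and ($\alpha(a^n-1)=0$ in $\mathds{k}[G]$ or $\chi^n=1$). $H_{\mathcal{D}}$ is the Hopf algebra generated as an algebra by $G$ and $x$, subject to the group relations of $G$, $x^n=\alpha(a^n-1)$ and $xg=\chi(g)gx$ for $g\in G$, with $\Delta(x)=x\otimes a+1\otimes x$, $\Delta(g)=g\otimes g$ (so $\epsilon(g)=1$, $\epsilon(x)=0$). It has $\mathds{k}$-basis $\{gx^m: g\in G,\ 0\le m<n\}$. Hopf $q$-braces. Let $X$ be a coalgebra and $p,d\colon X\otimes X\to X$ linear maps with $\epsilon\circ p=\epsilon\circ d=\epsilon\otimes\epsilon$; write $x\cdot y=p(x\otimes y)$, $x\mathbin{:}y=d(x\otimes y)$. $(X,\cdot,\mathbin{:})$ is a $q$-magma coalgebra if the map $X\otimes X^{\mathrm{cop}}\to X^{\mathrm{cop}}\otimes X$, $x\otimes y\mapsto y_{(1)}\mathbin{:}x_{(2)}\otimes x_{(1)}\cdot y_{(2)}$, is a coalgebra morphism. It is left regular if $x\otimes y\mapsto x\cdot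 y_{(1)}\otimes y_{(2)}$ is bijective on $X\otimes X$, right regular if $x\otimes y\mapsto x\mathbin{:}y_{(2)}\otimes y_{(1)}$ is bijective, and regular if it is both. A $q$-cycle coalgebra is a left regular $q$-magma coalgebra such that for all $u,v,w$: $(u\cdot v_{(1)})\cdot(w\mathbin{:}v_{(2)})=(u\cdot w_{(2)})\cdot(v\cdot w_{(1)})$, $(u\cdot v_{(1)})\mathbin{:}(w\cdot v_{(2)})=(u\mathbin{:}w_{(2)})\cdot(v\mathbin{:}w_{(1)})$, $(u\mathbin{:}v_{(1)})\mathbin{:}(w\mathbin{:}v_{(2)})=(u\mathbin{:}w_{(2)})\mathbin{:}(v\cdot w_{(1)})$. A Hopf $q$-brace is a Hopf algebra $H$ with a regular $q$-cycle coalgebra structure $(H,\cdot,\mathbin{:})$ such that $(H,\cdot)$ and $(H,\mathbin{:})$ are right $H^{\mathrm{op}}$-modules (i.e. $h\cdot 1=h$, $h\cdot kl=(h\cdot l)\cdot k$, and likewise for $\mathbin{:}$) and, for all $h,k,l\in H$, $hk\cdot l=(h\cdot(l_{(1)}\mathbin{:}k_{(2)}))(k_{(1)}\cdot l_{(2)})$ and $hk\mathbin{:}l=(h\mathbin{:}(l_{(1)}\cdot k_{(2)}))(k_{(1)}\mathbin{:}l_{(2)})$. Socle. For a Hopf $q$-brace $\mathcal{H}=(H,\cdot,\mathbin{:})$ with bijective antipode, $\mathrm{Soc}(\mathcal{H}):=\{u\in H: u_{(1)}\otimes v\cdot u_{(2)}\otimes u_{(3)}=u_{(1)}\otimes v\mathbin{:}u_{(2)}\otimes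 u_{(3)}=u_{(1)}\otimes v\otimes u_{(2)}\text{ for all }v\in H\}$. For the $q$-brace $(G,\cdot,\mathbin{:})$ obtained by restricting the operations to $G$, $\mathrm{Soc}(G,\cdot,\mathbin{:})=\{h\in G: k\cdot h=k\mathbin{:}h=k\text{ for all }k\in G\}$. Known facts: for a Hopf $q$-brace on $H_{\mathcal{D}}$ with $x\cdot x=x\mathbin{:}x=0$, one has $a\cdot g=a\mathbin{:}g=a$, $g\cdot a=g\mathbin{:}a=g$ for $g\in G$, $\lambda(a)=\xi(a)^{-1}$, and for all $h,g\in G$, $j,j'\in\mathbb{N}_0$: $hx^j\cdot gx^{j'}=\lambda(g)^j(h\cdot g)x^j$ and $hx^j\mathbin{:}gx^{j'}=\xi(g)^j(h\mathbin{:}g)x^j$ if $j'=0$, and both are $0$ if $j'>0$. *)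

theory Defs
  imports "HOL-Algebra.Group" "HOL-Computational_Algebra.Computational_Algebra"
begin

section \<open>Tensors over a field\<close>

text \<open>
  A list \<open>[(u\<^sub>1, v\<^sub>1), \<dots>, (u\<^sub>r, v\<^sub>r)]\<close> stands for the tensor \<open>u\<^sub>1 \<otimes> v\<^sub>1 + \<dots> + u\<^sub>r \<otimes> v\<^sub>r\<close>, and
  similarly for three and four factors.  Two lists stand for the same tensor iff every multilinear
  form takes the same value on them: this is the universal property of the tensor product, where
  over a field it suffices to test with scalar-valued forms.
\<close>

definition bilinear_form :: "('k::field \<Rightarrow> 'v::ab_group_add \<Rightarrow> 'v) \<Rightarrow> ('v \<Rightarrow> 'v \<Rightarrow> 'k) \<Rightarrow> bool" where
  "bilinear_form scale \<beta> \<longleftrightarrow>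
     (\<forall>v. Vector_Spaces.linear scale (*) (\<lambda>u. \<beta> u v)) \<and>
     (\<forall>u. Vector_Spaces.linear scale (*) (\<lambda>v. \<beta> u v))"

definition trilinear_form ::
    "('k::field \<Rightarrow> 'v::ab_group_add \<Rightarrow> 'v) \<Rightarrow> ('v \<Rightarrow> 'v \<Rightarrow> 'v \<Rightarrow> 'k) \<Rightarrow> bool" where
  "trilinear_form scale \<beta> \<longleftrightarrow>
     (\<forall>v w. Vector_Spaces.linear scale (*) (\<lambda>u. \<beta> u v w)) \<and>
     (\<forall>u w. Vector_Spaces.linear scale (*) (\<lambda>v. \<beta> u v w)) \<and>
     (\<forall>u v. Vector_Spaces.linear scale (*) (\<lambda>w. \<beta> u v w))"

definition quadrilinear_form ::
    "('k::field \<Rightarrow> 'v::ab_group_add \<Rightarrow> 'v) \<Rightarrow> ('v \<Rightarrow> 'v \<Rightarrow> 'v \<Rightarrow> 'v \<Rightarrow> 'k) \<Rightarrow> bool" where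
  "quadrilinear_form scale \<beta> \<longleftrightarrow>
     (\<forall>v w z. Vector_Spaces.linear scale (*) (\<lambda>u. \<beta> u v w z)) \<and>
     (\<forall>u w z. Vector_Spaces.linear scale (*) (\<lambda>v. \<beta> u v w z)) \<and>
     (\<forall>u v z. Vector_Spaces.linear scale (*) (\<lambda>w. \<beta> u v w z)) \<and>
     (\<forall>u v w. Vector_Spaces.linear scale (*) (\<lambda>z. \<beta> u v w z))"

definition teq2 ::
    "('k::field \<Rightarrow> 'v::ab_group_add \<Rightarrow> 'v) \<Rightarrow> ('v \<times> 'v) list \<Rightarrow> ('v \<times> 'v) list \<Rightarrow> bool" where
  "teq2 scale s t \<longleftrightarrow>
     (\<forall>\<beta>. bilinear_form scale \<beta> \<longrightarrow> (\<Sum>(u, v)\<leftarrow>s. \<beta> u v) = (\<Sum>(u, v)\<leftarrow>t. \<beta> u v))"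

definition teq3 ::
    "('k::field \<Rightarrow> 'v::ab_group_add \<Rightarrow> 'v) \<Rightarrow> ('v \<times> 'v \<times> 'v) list \<Rightarrow> ('v \<times> 'v \<times> 'v) list \<Rightarrow> bool" where
  "teq3 scale s t \<longleftrightarrow>
     (\<forall>\<beta>. trilinear_form scale \<beta> \<longrightarrow>
        (\<Sum>(u, v, w)\<leftarrow>s. \<beta> u v w) = (\<Sum>(u, v, w)\<leftarrow>t. \<beta> u v w))"

definition teq4 ::
    "('k::field \<Rightarrow> 'v::ab_group_add \<Rightarrow> 'v) \<Rightarrow>
       ('v \<times> 'v \<times> 'v \<times> 'v) list \<Rightarrow> ('v \<times> 'v \<times> 'v \<times> 'v) list \<Rightarrow> bool" where
  "teq4 scale s t \<longleftrightarrow>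
     (\<forall>\<beta>. quadrilinear_form scale \<beta> \<longrightarrow>
        (\<Sum>(u, v, w, z)\<leftarrow>s. \<beta> u v w z) = (\<Sum>(u, v, w, z)\<leftarrow>t. \<beta> u v w z))"

text \<open>
  Bijectivity of a linear endomorphism of \<open>V \<otimes> V\<close> which is given on representing lists.
\<close>

definition tensor_bij ::
    "('k::field \<Rightarrow> 'v::ab_group_add \<Rightarrow> 'v) \<Rightarrow> (('v \<times> 'v) list \<Rightarrow> ('v \<times> 'v) list) \<Rightarrow> bool" where
  "tensor_bij scale F \<longleftrightarrow>
     (\<forall>s t. teq2 scale (F s) (F t) \<longrightarrow> teq2 scale s t) \<and>
     (\<forall>t. \<exists>s. teq2 scale (F s) t)"

definition bilinear_op :: "('k::field \<Rightarrow> 'v::ab_group_add \<Rightarrow> 'v) \<Rightarrow> ('v \<Rightarrow> 'v \<Rightarrow> 'v) \<Rightarrow> bool" where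
  "bilinear_op scale f \<longleftrightarrow>
     (\<forall>v. Vector_Spaces.linear scale scale (\<lambda>u. f u v)) \<and>
     (\<forall>u. Vector_Spaces.linear scale scale (\<lambda>v. f u v))"


section \<open>Coalgebras and Hopf algebras\<close>

text \<open>
  The value \<open>\<Delta> u\<close> is a list representing the comultiplication of \<open>u\<close>, so that the Sweedler notation
  \<open>f u\<^sub>(\<^sub>1\<^sub>) u\<^sub>(\<^sub>2\<^sub>)\<close> reads \<open>\<Sum>(u1, u2)\<leftarrow>\<Delta> u. f u1 u2\<close>.  The choice of representatives is irrelevant; in
  particular \<open>\<Delta>\<close> is linear only up to equality of tensors.
\<close>

locale coalgebra = vector_space scale
  for scale :: "'k::field \<Rightarrow> 'v::ab_group_add \<Rightarrow> 'v" +
  fixes \<Delta> :: "'v \<Rightarrow> ('v \<times> 'v) list"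
    and \<epsilon> :: "'v \<Rightarrow> 'k"
  assumes comult_add: "teq2 scale (\<Delta> (u + v)) (\<Delta> u @ \<Delta> v)"
    and comult_scale: "teq2 scale (\<Delta> (scale c u)) [(scale c u1, u2). (u1, u2) \<leftarrow> \<Delta> u]"
    and counit_linear: "Vector_Spaces.linear scale (*) \<epsilon>"
    and coassoc: "teq3 scale
          [(u11, u12, u2). (u1, u2) \<leftarrow> \<Delta> u, (u11, u12) \<leftarrow> \<Delta> u1]
          [(u1, u21, u22). (u1, u2) \<leftarrow> \<Delta> u, (u21, u22) \<leftarrow> \<Delta> u2]"
    and counit_left: "(\<Sum>(u1, u2)\<leftarrow>\<Delta> u. scale (\<epsilon> u1) u2) = u"
    and counit_right: "(\<Sum>(u1, u2)\<leftarrow>\<Delta> u. scale (\<epsilon> u2) u1) = u"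

locale unital_algebra = vector_space scale
  for scale :: "'k::field \<Rightarrow> 'h::ring_1 \<Rightarrow> 'h" +
  assumes scale_mult_left: "scale c u * v = scale c (u * v)"
    and scale_mult_right: "u * scale c v = scale c (u * v)"

locale bialgebra = unital_algebra scale + coalgebra scale \<Delta> \<epsilon>
  for scale :: "'k::field \<Rightarrow> 'h::ring_1 \<Rightarrow> 'h" and \<Delta> \<epsilon> +
  assumes comult_mult:
      "teq2 scale (\<Delta> (u * v)) [(u1 * v1, u2 * v2). (u1, u2) \<leftarrow> \<Delta> u, (v1, v2) \<leftarrow> \<Delta> v]"
    and comult_one: "teq2 scale (\<Delta> 1) [(1, 1)]"
    and counit_mult: "\<epsilon> (u * v) = \<epsilon> u * \<epsilon> v"
    and counit_one: "\<epsilon> 1 = 1"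

locale hopf_algebra = bialgebra scale \<Delta> \<epsilon>
  for scale :: "'k::field \<Rightarrow> 'h::ring_1 \<Rightarrow> 'h" and \<Delta> \<epsilon> +
  fixes S :: "'h \<Rightarrow> 'h"
  assumes antipode_linear: "Vector_Spaces.linear scale scale S"
    and antipode_left: "(\<Sum>(u1, u2)\<leftarrow>\<Delta> u. S u1 * u2) = scale (\<epsilon> u) 1"
    and antipode_right: "(\<Sum>(u1, u2)\<leftarrow>\<Delta> u. u1 * S u2) = scale (\<epsilon> u) 1"


section \<open>Rank one pointed Hopf algebras\<close>

definition group_character :: "('g, 'm) monoid_scheme \<Rightarrow> ('g \<Rightarrow> 'k::field) \<Rightarrow> bool" where
  "group_character G \<chi> \<longleftrightarrow>
     (\<forall>g \<in> carrier G. \<chi> g \<noteq> 0) \<and>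
     (\<forall>g \<in> carrier G. \<forall>h \<in> carrier G. \<chi> (g \<otimes>\<^bsub>G\<^esub> h) = \<chi> g * \<chi> h)"

text \<open>Only used for elements of finite order, such as the values of a character of a finite group.\<close>

definition mult_order :: "'k::field \<Rightarrow> nat" where
  "mult_order c = (LEAST m. 0 < m \<and> c ^ m = 1)"

text \<open>
  The group elements are linearly independent in the group algebra, so \<open>\<alpha>(a\<^sup>n - 1) = 0\<close> there means
  that \<open>\<alpha> = 0\<close> or \<open>a\<^sup>n = 1\<close> in the group.
\<close>

definition rank_one_datum ::
    "('g, 'm) monoid_scheme \<Rightarrow> ('g \<Rightarrow> 'k::field) \<Rightarrow> 'g \<Rightarrow> 'k \<Rightarrow> bool" where
  "rank_one_datum G \<chi> a \<alpha> \<longleftrightarrow>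
     group G \<and> finite (carrier G) \<and> group_character G \<chi> \<and>
     a \<in> carrier G \<and> (\<forall>g \<in> carrier G. a \<otimes>\<^bsub>G\<^esub> g = g \<otimes>\<^bsub>G\<^esub> a) \<and>
     (let n = mult_order (\<chi> a) in
        n > 1 \<and>
        (\<alpha> = 0 \<or> a [^]\<^bsub>G\<^esub> n = \<one>\<^bsub>G\<^esub> \<or> (\<forall>g \<in> carrier G. \<chi> g ^ n = 1)))"

text \<open>
  The algebra with generators \<open>G\<close> and \<open>x\<close> and the relations below is the algebra of terms modulo the
  least congruence which contains the axioms of unital associative algebras and the relations.
\<close>

datatype ('k, 'g) alg_term =
    Const 'k
  | Gen 'g
  | GenX
  | Add "('k, 'g) alg_term" "('k, 'g) alg_term"
  | Mult "('k, 'g) alg_term" "('k, 'g) alg_term"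

fun term_power :: "('k::field, 'g) alg_term \<Rightarrow> nat \<Rightarrow> ('k, 'g) alg_term" where
  "term_power t 0 = Const 1"
| "term_power t (Suc m) = Mult t (term_power t m)"

inductive rank_one_cong ::
    "('g, 'm) monoid_scheme \<Rightarrow> ('g \<Rightarrow> 'k::field) \<Rightarrow> 'g \<Rightarrow> 'k \<Rightarrow>
       ('k, 'g) alg_term \<Rightarrow> ('k, 'g) alg_term \<Rightarrow> bool"
  for G :: "('g, 'm) monoid_scheme" and \<chi> :: "'g \<Rightarrow> 'k::field" and a :: 'g and \<alpha> :: 'k
where
  cong_refl: "rank_one_cong G \<chi> a \<alpha> s s"
| cong_sym: "rank_one_cong G \<chi> a \<alpha> s t \<Longrightarrow> rank_one_cong G \<chi> a \<alpha> t s"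
| cong_trans:
    "rank_one_cong G \<chi> a \<alpha> s t \<Longrightarrow> rank_one_cong G \<chi> a \<alpha> t u \<Longrightarrow> rank_one_cong G \<chi> a \<alpha> s u"
| cong_Add:
    "rank_one_cong G \<chi> a \<alpha> s s' \<Longrightarrow> rank_one_cong G \<chi> a \<alpha> t t' \<Longrightarrow>
     rank_one_cong G \<chi> a \<alpha> (Add s t) (Add s' t')"
| cong_Mult:
    "rank_one_cong G \<chi> a \<alpha> s s' \<Longrightarrow> rank_one_cong G \<chi> a \<alpha> t t' \<Longrightarrow>
     rank_one_cong G \<chi> a \<alpha> (Mult s t) (Mult s' t')"
| ax_add_assoc: "rank_one_cong G \<chi> a \<alpha> (Add (Add s t) u) (Add s (Add t u))"
| ax_add_comm: "rank_one_cong G \<chi> a \<alpha> (Add s t) (Add t s)"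
| ax_add_zero: "rank_one_cong G \<chi> a \<alpha> (Add (Const 0) s) s"
| ax_add_minus: "rank_one_cong G \<chi> a \<alpha> (Add s (Mult (Const (- 1)) s)) (Const 0)"
| ax_mult_assoc: "rank_one_cong G \<chi> a \<alpha> (Mult (Mult s t) u) (Mult s (Mult t u))"
| ax_one_mult: "rank_one_cong G \<chi> a \<alpha> (Mult (Const 1) s) s"
| ax_mult_one: "rank_one_cong G \<chi> a \<alpha> (Mult s (Const 1)) s"
| ax_distrib_right: "rank_one_cong G \<chi> a \<alpha> (Mult (Add s t) u) (Add (Mult s u) (Mult t u))"
| ax_distrib_left: "rank_one_cong G \<chi> a \<alpha> (Mult s (Add t u)) (Add (Mult s t) (Mult s u))"
| ax_const_add: "rank_one_cong G \<chi> a \<alpha> (Add (Const c) (Const d)) (Const (c + d))"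
| ax_const_mult: "rank_one_cong G \<chi> a \<alpha> (Mult (Const c) (Const d)) (Const (c * d))"
| ax_const_central: "rank_one_cong G \<chi> a \<alpha> (Mult s (Const c)) (Mult (Const c) s)"
| rel_group_mult: "g \<in> carrier G \<Longrightarrow> h \<in> carrier G \<Longrightarrow>
     rank_one_cong G \<chi> a \<alpha> (Mult (Gen g) (Gen h)) (Gen (g \<otimes>\<^bsub>G\<^esub> h))"
| rel_group_one: "rank_one_cong G \<chi> a \<alpha> (Gen \<one>\<^bsub>G\<^esub>) (Const 1)"
| rel_x_power: "n = mult_order (\<chi> a) \<Longrightarrow>
     rank_one_cong G \<chi> a \<alpha> (term_power GenX n)
       (Mult (Const \<alpha>) (Add (Gen (a [^]\<^bsub>G\<^esub> n)) (Const (- 1))))"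
| rel_x_group: "g \<in> carrier G \<Longrightarrow>
     rank_one_cong G \<chi> a \<alpha> (Mult GenX (Gen g)) (Mult (Const (\<chi> g)) (Mult (Gen g) GenX))"

primrec term_value ::
    "('k \<Rightarrow> 'h::ring_1 \<Rightarrow> 'h) \<Rightarrow> ('g \<Rightarrow> 'h) \<Rightarrow> 'h \<Rightarrow> ('k, 'g) alg_term \<Rightarrow> 'h" where
  "term_value scale \<iota> x (Const c) = scale c 1"
| "term_value scale \<iota> x (Gen g) = \<iota> g"
| "term_value scale \<iota> x GenX = x"
| "term_value scale \<iota> x (Add s t) = term_value scale \<iota> x s + term_value scale \<iota> x t"
| "term_value scale \<iota> x (Mult s t) = term_value scale \<iota> x s * term_value scale \<iota> x t"

definition terms_over :: "('g, 'm) monoid_scheme \<Rightarrow> ('k, 'g) alg_term set" where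
  "terms_over G = {t. set2_alg_term t \<subseteq> carrier G}"

text \<open>
  A Hopf algebra is (isomorphic to) the one attached to the datum iff it is presented by these
  generators and relations, \<open>\<iota>\<close> and \<open>x\<close> being the images of the generators, and \<open>\<Delta>\<close> takes the
  prescribed values on the generators.
\<close>

locale rank_one_hopf_algebra = hopf_algebra scale \<Delta> \<epsilon> S
  for scale :: "'k::field \<Rightarrow> 'h::ring_1 \<Rightarrow> 'h" and \<Delta> \<epsilon> S +
  fixes G :: "('g, 'm) monoid_scheme"
    and \<chi> :: "'g \<Rightarrow> 'k"
    and a :: 'g
    and \<alpha> :: 'k
    and \<iota> :: "'g \<Rightarrow> 'h"
    and x :: 'h
  assumes datum: "rank_one_datum G \<chi> a \<alpha>"
    and generated: "\<exists>t \<in> terms_over G. term_value scale \<iota> x t = u"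
    and presented: "s \<in> terms_over G \<Longrightarrow> t \<in> terms_over G \<Longrightarrow>
          term_value scale \<iota> x s = term_value scale \<iota> x t \<longleftrightarrow> rank_one_cong G \<chi> a \<alpha> s t"
    and comult_group: "g \<in> carrier G \<Longrightarrow> teq2 scale (\<Delta> (\<iota> g)) [(\<iota> g, \<iota> g)]"
    and comult_x: "teq2 scale (\<Delta> x) [(x, \<iota> a), (1, x)]"


section \<open>Hopf q-braces\<close>

text \<open>
  The operations \<open>\<cdot>\<close> and \<open>\<^bold>:\<close> bind weaker than multiplication and stronger than addition.
  In \<open>q_comult\<close> the comultiplications of \<open>X \<otimes> X\<^sup>c\<^sup>o\<^sup>p\<close> and \<open>X\<^sup>c\<^sup>o\<^sup>p \<otimes> X\<close> are
  \<open>x \<otimes> y \<mapsto> x\<^sub>(\<^sub>1\<^sub>) \<otimes> y\<^sub>(\<^sub>2\<^sub>) \<otimes> x\<^sub>(\<^sub>2\<^sub>) \<otimes> y\<^sub>(\<^sub>1\<^sub>)\<close> and \<open>u \<otimes> v \<mapsto> u\<^sub>(\<^sub>2\<^sub>) \<otimes> v\<^sub>(\<^sub>1\<^sub>) \<otimes> u\<^sub>(\<^sub>1\<^sub>) \<otimes> v\<^sub>(\<^sub>2\<^sub>)\<close>.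
\<close>

definition q_map ::
    "('v \<Rightarrow> ('v \<times> 'v) list) \<Rightarrow> ('v \<Rightarrow> 'v \<Rightarrow> 'v) \<Rightarrow> ('v \<Rightarrow> 'v \<Rightarrow> 'v) \<Rightarrow> 'v \<Rightarrow> 'v \<Rightarrow> ('v \<times> 'v) list" where
  "q_map \<Delta> p d u v = [(d v1 u2, p u1 v2). (u1, u2) \<leftarrow> \<Delta> u, (v1, v2) \<leftarrow> \<Delta> v]"

locale q_magma_coalgebra = coalgebra scale \<Delta> \<epsilon>
  for scale :: "'k::field \<Rightarrow> 'v::ab_group_add \<Rightarrow> 'v" and \<Delta> \<epsilon> +
  fixes p :: "'v \<Rightarrow> 'v \<Rightarrow> 'v"  (infixl \<open>\<cdot>\<close> 68)
    and d :: "'v \<Rightarrow> 'v \<Rightarrow> 'v"  (infixl \<open>\<^bold>:\<close> 68)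
  assumes p_bilinear: "bilinear_op scale p"
    and d_bilinear: "bilinear_op scale d"
    and counit_p: "\<epsilon> (u \<cdot> v) = \<epsilon> u * \<epsilon> v"
    and counit_d: "\<epsilon> (u \<^bold>: v) = \<epsilon> u * \<epsilon> v"
    and q_comult: "teq4 scale
          [(r2, s1, r1, s2). (r, s) \<leftarrow> q_map \<Delta> p d u v, (r1, r2) \<leftarrow> \<Delta> r, (s1, s2) \<leftarrow> \<Delta> s]
          [(r, s, r', s'). (u1, u2) \<leftarrow> \<Delta> u, (v1, v2) \<leftarrow> \<Delta> v,
             (r, s) \<leftarrow> q_map \<Delta> p d u1 v2, (r', s') \<leftarrow> q_map \<Delta> p d u2 v1]"
    and q_counit: "(\<Sum>(r, s)\<leftarrow>q_map \<Delta> p d u v. \<epsilon> r * \<epsilon> s) = \<epsilon> u * \<epsilon> v"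

locale left_regular_q_magma_coalgebra = q_magma_coalgebra +
  assumes left_regular:
    "tensor_bij scale (\<lambda>t. [(u \<cdot> v1, v2). (u, v) \<leftarrow> t, (v1, v2) \<leftarrow> \<Delta> v])"

locale right_regular_q_magma_coalgebra = q_magma_coalgebra +
  assumes right_regular:
    "tensor_bij scale (\<lambda>t. [(u \<^bold>: v2, v1). (u, v) \<leftarrow> t, (v1, v2) \<leftarrow> \<Delta> v])"

locale q_cycle_coalgebra = left_regular_q_magma_coalgebra +
  assumes q_cycle1:
      "(\<Sum>(v1, v2)\<leftarrow>\<Delta> v. (u \<cdot> v1) \<cdot> (w \<^bold>: v2)) = (\<Sum>(w1, w2)\<leftarrow>\<Delta> w. (u \<cdot> w2) \<cdot> (v \<cdot> w1))"
    and q_cycle2: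
      "(\<Sum>(v1, v2)\<leftarrow>\<Delta> v. (u \<cdot> v1) \<^bold>: (w \<cdot> v2)) = (\<Sum>(w1, w2)\<leftarrow>\<Delta> w. (u \<^bold>: w2) \<cdot> (v \<^bold>: w1))"
    and q_cycle3:
      "(\<Sum>(v1, v2)\<leftarrow>\<Delta> v. (u \<^bold>: v1) \<^bold>: (w \<^bold>: v2)) = (\<Sum>(w1, w2)\<leftarrow>\<Delta> w. (u \<^bold>: w2) \<^bold>: (v \<cdot> w1))"

locale hopf_q_brace =
  hopf_algebra scale \<Delta> \<epsilon> S + q_cycle_coalgebra scale \<Delta> \<epsilon> p d +
  right_regular_q_magma_coalgebra scale \<Delta> \<epsilon> p d
  for scale :: "'k::field \<Rightarrow> 'h::ring_1 \<Rightarrow> 'h" and \<Delta> \<epsilon> S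
    and p :: "'h \<Rightarrow> 'h \<Rightarrow> 'h"  (infixl \<open>\<cdot>\<close> 68)
    and d :: "'h \<Rightarrow> 'h \<Rightarrow> 'h"  (infixl \<open>\<^bold>:\<close> 68) +
  assumes p_one: "h \<cdot> 1 = h"
    and p_mult: "h \<cdot> k * l = (h \<cdot> l) \<cdot> k"
    and d_one: "h \<^bold>: 1 = h"
    and d_mult: "h \<^bold>: k * l = (h \<^bold>: l) \<^bold>: k"
    and mult_p: "h * k \<cdot> l =
          (\<Sum>(k1, k2)\<leftarrow>\<Delta> k. \<Sum>(l1, l2)\<leftarrow>\<Delta> l. (h \<cdot> (l1 \<^bold>: k2)) * (k1 \<cdot> l2))"
    and mult_d: "h * k \<^bold>: l =
          (\<Sum>(k1, k2)\<leftarrow>\<Delta> k. \<Sum>(l1, l2)\<leftarrow>\<Delta> l. (h \<^bold>: (l1 \<cdot> k2)) * (k1 \<^bold>: l2))"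


section \<open>Socles\<close>

definition Socle ::
    "('k::field \<Rightarrow> 'h::ring_1 \<Rightarrow> 'h) \<Rightarrow> ('h \<Rightarrow> ('h \<times> 'h) list) \<Rightarrow>
       ('h \<Rightarrow> 'h \<Rightarrow> 'h) \<Rightarrow> ('h \<Rightarrow> 'h \<Rightarrow> 'h) \<Rightarrow> 'h set" where
  "Socle scale \<Delta> p d = {u. \<forall>v.
     teq3 scale [(u1, p v u2, u3). (u1, u') \<leftarrow> \<Delta> u, (u2, u3) \<leftarrow> \<Delta> u'] [(u1, v, u2). (u1, u2) \<leftarrow> \<Delta> u] \<and>
     teq3 scale [(u1, d v u2, u3). (u1, u') \<leftarrow> \<Delta> u, (u2, u3) \<leftarrow> \<Delta> u'] [(u1, v, u2). (u1, u2) \<leftarrow> \<Delta> u]}"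

text \<open>The q-brace on \<open>G\<close> is the restriction of \<open>p\<close> and \<open>d\<close> along the embedding \<open>\<iota>\<close>.\<close>

definition group_Socle ::
    "('g, 'm) monoid_scheme \<Rightarrow> ('g \<Rightarrow> 'h) \<Rightarrow> ('h \<Rightarrow> 'h \<Rightarrow> 'h) \<Rightarrow> ('h \<Rightarrow> 'h \<Rightarrow> 'h) \<Rightarrow> 'g set" where
  "group_Socle G \<iota> p d =
     {h \<in> carrier G. \<forall>k \<in> carrier G. p (\<iota> k) (\<iota> h) = \<iota> k \<and> d (\<iota> k) (\<iota> h) = \<iota> k}"

definition is_internal_direct_sum ::
    "'v::ab_group_add set \<Rightarrow> 'i set \<Rightarrow> ('i \<Rightarrow> 'v set) \<Rightarrow> bool" where
  "is_internal_direct_sum U I A \<longleftrightarrow>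
     U = {\<Sum>i\<in>I. f i | f. \<forall>i\<in>I. f i \<in> A i} \<and>
     (\<forall>f. (\<forall>i\<in>I. f i \<in> A i) \<and> (\<Sum>i\<in>I. f i) = 0 \<longrightarrow> (\<forall>i\<in>I. f i = 0))"

end

theory Submission
  imports Defs "HOL-Algebra.Multiplicative_Group"
begin

text \<open>
  The socle is computed by comparing coefficients with respect to the basis \<open>g x\<^sup>m\<close>, where \<open>g\<close>
  runs through the group and \<open>m < n\<close>.  Write \<open>q = \<chi>(a)\<close>.  Since
  \<open>\<Delta>(g x\<^sup>m) = \<Sum>\<^sub>i [m, i]\<^sub>q g x\<^sup>i \<otimes> g a\<^sup>i x\<^sup>m\<^sup>-\<^sup>i\<close> with Gaussian binomial coefficients
  (\<open>sweedler_basis\<close>), and since \<open>v \<cdot> g x\<^sup>j = 0\<close> for \<open>j > 0\<close> (\<open>p_basis\<close>), the element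
  \<open>u\<^sub>(\<^sub>1\<^sub>) \<otimes> v \<cdot> u\<^sub>(\<^sub>2\<^sub>) \<otimes> u\<^sub>(\<^sub>3\<^sub>)\<close> for \<open>u = g x\<^sup>m\<close> is
  \<open>\<Sum>\<^sub>i [m, i]\<^sub>q g x\<^sup>i \<otimes> v \<cdot> g a\<^sup>i \<otimes> g a\<^sup>i x\<^sup>m\<^sup>-\<^sup>i\<close>, and the outer legs of these summands are
  linearly independent, even for varying \<open>g\<close> and \<open>m\<close>.  Hence \<open>u\<close> lies in the socle iff, for every
  \<open>g x\<^sup>m\<close> which occurs in \<open>u\<close> and every \<open>i \<le> m\<close> with \<open>[m, i]\<^sub>q \<noteq> 0\<close>, the element \<open>g a\<^sup>i\<close> acts trivially by
  both operations.  The case \<open>i = 0\<close> says that \<open>g\<close> is in \<open>L\<close>.  The case \<open>i = 1\<close>, available for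
  \<open>m > 0\<close> because \<open>[m, 1]\<^sub>q = 1 + q + \<dots> + q\<^sup>m\<^sup>-\<^sup>1 \<noteq> 0\<close>, adds that \<open>a\<close> acts trivially, that is
  \<open>\<lambda>(a) = 1\<close>; and then all other cases follow (\<open>p_socle_iff\<close>, \<open>socle_iff\<close>).

  Three ingredients go into this.  That the \<open>g x\<^sup>m\<close> form a basis follows from an explicit
  representation of the generators and relations (\<open>act_cong\<close>, \<open>coord_basis\<close>, \<open>coord_expansion\<close>).
  The definition of a q-magma coalgebra amounts, via the counit, to both operations being
  coalgebra morphisms and to the exchange law
  \<open>u\<^sub>(\<^sub>1\<^sub>) \<cdot> v\<^sub>(\<^sub>2\<^sub>) \<otimes> v\<^sub>(\<^sub>1\<^sub>) \<^bold>: u\<^sub>(\<^sub>2\<^sub>) = u\<^sub>(\<^sub>2\<^sub>) \<cdot> v\<^sub>(\<^sub>1\<^sub>) \<otimes> v\<^sub>(\<^sub>2\<^sub>) \<^bold>: u\<^sub>(\<^sub>1\<^sub>)\<close>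
  (\<open>sweedler_p\<close>, \<open>sweedler_d\<close>, \<open>q_exchange\<close>).  Finally, the exchange law on \<open>x \<otimes> g\<close> and on \<open>x \<otimes> x\<close>
  gives \<open>g \<cdot> a = g\<close>, \<open>g \<cdot> x = 0\<close> and \<open>\<lambda>(a) \<xi>(a) = 1\<close>, from which the rule for \<open>h k \<cdot> l\<close> with \<open>k = x\<close>
  determines the actions of \<open>x\<close> and of the group on every \<open>h x\<^sup>j\<close>.
\<close>

section \<open>Linear forms and tensors\<close>

lemma sum_list_map_concat: "sum_list (map f (concat xss)) = (\<Sum>xs\<leftarrow>xss. sum_list (map f xs))"
  by (induction xss) simp_all

context vector_space
begin

lemma linear_form_iff:
  "Vector_Spaces.linear scale (*) \<phi> \<longleftrightarrow>
     (\<forall>u v. \<phi> (u + v) = \<phi> u + \<phi> v) \<and> (\<forall>c u. \<phi> (scale c u) = c * \<phi> u)"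
proof -
  have "vector_space ((*) :: 'a \<Rightarrow> 'a \<Rightarrow> 'a)"
    by unfold_locales (simp_all add: algebra_simps)
  then show ?thesis
    using vector_space_axioms by (simp add: Vector_Spaces.linear_iff)
qed

lemma linear_op_iff:
  "Vector_Spaces.linear scale scale f \<longleftrightarrow>
     (\<forall>u v. f (u + v) = f u + f v) \<and> (\<forall>c u. f (scale c u) = scale c (f u))"
  using vector_space_axioms by (simp add: Vector_Spaces.linear_iff)

lemma linear_form_sum:
  assumes "Vector_Spaces.linear scale (*) \<phi>"
  shows "\<phi> (\<Sum>i\<in>I. f i) = (\<Sum>i\<in>I. \<phi> (f i))"
proof -
  have add: "\<phi> (u + v) = \<phi> u + \<phi> v" and sc: "\<phi> (scale c u) = c * \<phi> u" for u v c
    using assms by (simp_all add: linear_form_iff)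
  have "\<phi> 0 = 0"
    using sc[of 0 0] by simp
  then show ?thesis
    by (induction I rule: infinite_finite_induct) (simp_all add: add)
qed

lemma linear_form_sum_list:
  assumes "Vector_Spaces.linear scale (*) \<phi>"
  shows "\<phi> (sum_list us) = (\<Sum>u\<leftarrow>us. \<phi> u)"
proof -
  have add: "\<phi> (u + v) = \<phi> u + \<phi> v" and sc: "\<phi> (scale c u) = c * \<phi> u" for u v c
    using assms by (simp_all add: linear_form_iff)
  have "\<phi> 0 = 0"
    using sc[of 0 0] by simp
  then show ?thesis
    by (induction us) (simp_all add: add)
qed

lemma bilinear_form_iff:
  "bilinear_form scale \<beta> \<longleftrightarrow>
     (\<forall>u u' v. \<beta> (u + u') v = \<beta> u v + \<beta> u' v) \<and> (\<forall>c u v. \<beta> (scale c u) v = c * \<beta> u v) \<and>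
     (\<forall>u v v'. \<beta> u (v + v') = \<beta> u v + \<beta> u v') \<and> (\<forall>c u v. \<beta> u (scale c v) = c * \<beta> u v)"
  unfolding bilinear_form_def linear_form_iff by blast

lemma trilinear_form_iff:
  "trilinear_form scale \<beta> \<longleftrightarrow>
     (\<forall>u u' v w. \<beta> (u + u') v w = \<beta> u v w + \<beta> u' v w) \<and>
     (\<forall>c u v w. \<beta> (scale c u) v w = c * \<beta> u v w) \<and>
     (\<forall>u v v' w. \<beta> u (v + v') w = \<beta> u v w + \<beta> u v' w) \<and>
     (\<forall>c u v w. \<beta> u (scale c v) w = c * \<beta> u v w) \<and>
     (\<forall>u v w w'. \<beta> u v (w + w') = \<beta> u v w + \<beta> u v w') \<and>
     (\<forall>c u v w. \<beta> u v (scale c w) = c * \<beta> u v w)"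
  unfolding trilinear_form_def linear_form_iff by (rule iffI; simp)

lemma bilinear_op_iff:
  "bilinear_op scale f \<longleftrightarrow>
     (\<forall>u u' v. f (u + u') v = f u v + f u' v) \<and> (\<forall>c u v. f (scale c u) v = scale c (f u v)) \<and>
     (\<forall>u v v'. f u (v + v') = f u v + f u v') \<and> (\<forall>c u v. f u (scale c v) = scale c (f u v))"
  unfolding bilinear_op_def linear_op_iff by blast

end

context coalgebra
begin

text \<open>
  Equality of tensors is tested by forms, so the comultiplication is used only through the
  expressions \<open>\<beta> u\<^sub>(\<^sub>1\<^sub>) u\<^sub>(\<^sub>2\<^sub>)\<close>, which depend linearly on \<open>u\<close>.
\<close>

definition sweedler :: "('v \<Rightarrow> 'v \<Rightarrow> 'k) \<Rightarrow> 'v \<Rightarrow> 'k" where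
  "sweedler \<beta> u = (\<Sum>(u1, u2)\<leftarrow>\<Delta> u. \<beta> u1 u2)"

lemma sweedler_cong:
  assumes "teq2 scale (\<Delta> u) t" and "bilinear_form scale \<beta>"
  shows "sweedler \<beta> u = (\<Sum>(u1, u2)\<leftarrow>t. \<beta> u1 u2)"
  using assms unfolding sweedler_def teq2_def by blast

lemma sweedler_linear:
  assumes "bilinear_form scale \<beta>"
  shows "Vector_Spaces.linear scale (*) (sweedler \<beta>)"
  unfolding linear_form_iff
proof (intro conjI allI)
  show "sweedler \<beta> (u + v) = sweedler \<beta> u + sweedler \<beta> v" for u v
    using sweedler_cong[OF comult_add[of u v] assms] by (simp add: sweedler_def)
  show "sweedler \<beta> (scale c u) = c * sweedler \<beta> u" for c u
    using sweedler_cong[OF comult_scale[of c u] assms] assms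
    by (simp add: sweedler_def bilinear_form_iff sum_list_const_mult o_def case_prod_unfold)
qed

lemma sweedler_scale:
  "bilinear_form scale \<beta> \<Longrightarrow> sweedler \<beta> (scale c u) = c * sweedler \<beta> u"
  using sweedler_linear by (simp add: linear_form_iff)

lemma sweedler_add_form:
  "sweedler (\<lambda>u v. \<beta> u v + \<gamma> u v) w = sweedler \<beta> w + sweedler \<gamma> w"
  by (simp add: sweedler_def sum_list_addf case_prod_unfold)

lemma sweedler_mult_form: "sweedler (\<lambda>u v. c * \<beta> u v) w = c * sweedler \<beta> w"
  by (simp add: sweedler_def sum_list_const_mult case_prod_unfold)

lemma sweedler_swap:
  "sweedler (\<lambda>u1 u2. sweedler (\<lambda>v1 v2. F u1 u2 v1 v2) v) u =
   sweedler (\<lambda>v1 v2. sweedler (\<lambda>u1 u2. F u1 u2 v1 v2) u) v"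
proof -
  have "(\<Sum>i\<leftarrow>is. \<Sum>j\<leftarrow>js. f i j) = (\<Sum>j\<leftarrow>js. \<Sum>i\<leftarrow>is. f i j)"
    for f :: "'v \<times> 'v \<Rightarrow> 'v \<times> 'v \<Rightarrow> 'k" and "is" js
    by (induction "is") (simp_all add: sum_list_addf)
  then show ?thesis
    by (simp add: sweedler_def case_prod_unfold)
qed

lemma sweedler_counit_left:
  assumes "Vector_Spaces.linear scale (*) \<phi>"
  shows "sweedler (\<lambda>u1 u2. \<epsilon> u1 * \<phi> u2) u = \<phi> u"
proof -
  have "\<phi> u = \<phi> (\<Sum>(u1, u2)\<leftarrow>\<Delta> u. scale (\<epsilon> u1) u2)"
    by (simp add: counit_left)
  then show ?thesis
    using assms
    by (simp add: sweedler_def linear_form_sum_list o_def case_prod_unfold linear_form_iff)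
qed

lemma sweedler_counit_right:
  assumes "Vector_Spaces.linear scale (*) \<phi>"
  shows "sweedler (\<lambda>u1 u2. \<epsilon> u2 * \<phi> u1) u = \<phi> u"
proof -
  have "\<phi> u = \<phi> (\<Sum>(u1, u2)\<leftarrow>\<Delta> u. scale (\<epsilon> u2) u1)"
    by (simp add: counit_right)
  then show ?thesis
    using assms
    by (simp add: sweedler_def linear_form_sum_list o_def case_prod_unfold linear_form_iff)
qed

lemma counit_add [simp]: "\<epsilon> (u + v) = \<epsilon> u + \<epsilon> v"
  and counit_scale [simp]: "\<epsilon> (scale c u) = c * \<epsilon> u"
  using counit_linear by (simp_all add: linear_form_iff)

end

lemma (in bialgebra) sweedler_mult:
  assumes "bilinear_form scale \<beta>"
  shows "sweedler \<beta> (u * v) = sweedler (\<lambda>u1 u2. sweedler (\<lambda>v1 v2. \<beta> (u1 * v1) (u2 * v2)) v) u"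
  using sweedler_cong[OF comult_mult[of u v] assms]
  by (simp add: sweedler_def sum_list_map_concat o_def case_prod_unfold)

context q_magma_coalgebra
begin

lemma p_linear [simp]:
  "(u + u') \<cdot> v = u \<cdot> v + u' \<cdot> v" "scale c u \<cdot> v = scale c (u \<cdot> v)"
  "u \<cdot> (v + v') = u \<cdot> v + u \<cdot> v'" "u \<cdot> scale c v = scale c (u \<cdot> v)"
  using p_bilinear by (simp_all add: bilinear_op_iff)

lemma d_linear [simp]:
  "(u + u') \<^bold>: v = u \<^bold>: v + u' \<^bold>: v" "scale c u \<^bold>: v = scale c (u \<^bold>: v)"
  "u \<^bold>: (v + v') = u \<^bold>: v + u \<^bold>: v'" "u \<^bold>: scale c v = scale c (u \<^bold>: v)"
  using d_bilinear by (simp_all add: bilinear_op_iff)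

lemma q_map_sweedler:
  "(\<Sum>(r, s)\<leftarrow>q_map \<Delta> p d u v. \<delta> r s) =
   sweedler (\<lambda>u1 u2. sweedler (\<lambda>v1 v2. \<delta> (v1 \<^bold>: u2) (u1 \<cdot> v2)) v) u"
  by (simp add: q_map_def sweedler_def sum_list_map_concat o_def case_prod_unfold)

lemma q_map_counit_fst:
  assumes "Vector_Spaces.linear scale (*) \<phi>"
  shows "(\<Sum>(r, s)\<leftarrow>q_map \<Delta> p d u v. \<epsilon> r * \<phi> s) = \<phi> (u \<cdot> v)"
proof -
  have 1: "Vector_Spaces.linear scale (*) (\<lambda>w. \<phi> (w \<cdot> v'))"
    "Vector_Spaces.linear scale (*) (\<lambda>w. c * \<phi> (u' \<cdot> w))" for v' u' c
    using assms by (simp_all add: linear_form_iff algebra_simps)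
  have "(\<Sum>(r, s)\<leftarrow>q_map \<Delta> p d u v. \<epsilon> r * \<phi> s)
      = sweedler (\<lambda>u1 u2. sweedler (\<lambda>v1 v2. \<epsilon> v1 * (\<epsilon> u2 * \<phi> (u1 \<cdot> v2))) v) u"
    unfolding q_map_sweedler by (simp add: counit_d mult.assoc)
  also have "\<dots> = sweedler (\<lambda>u1 u2. \<epsilon> u2 * \<phi> (u1 \<cdot> v)) u"
    by (simp only: sweedler_counit_left[OF 1(2)])
  also have "\<dots> = \<phi> (u \<cdot> v)"
    by (rule sweedler_counit_right[OF 1(1)])
  finally show ?thesis .
qed

lemma q_map_counit_snd:
  assumes "Vector_Spaces.linear scale (*) \<phi>"
  shows "(\<Sum>(r, s)\<leftarrow>q_map \<Delta> p d u v. \<epsilon> s * \<phi> r) = \<phi> (v \<^bold>: u)"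
proof -
  have 1: "Vector_Spaces.linear scale (*) (\<lambda>w. \<phi> (v \<^bold>: w))"
    "Vector_Spaces.linear scale (*) (\<lambda>w. c * \<phi> (w \<^bold>: u'))" for v' u' c
    using assms by (simp_all add: linear_form_iff algebra_simps)
  have "(\<Sum>(r, s)\<leftarrow>q_map \<Delta> p d u v. \<epsilon> s * \<phi> r)
      = sweedler (\<lambda>u1 u2. sweedler (\<lambda>v1 v2. \<epsilon> v2 * (\<epsilon> u1 * \<phi> (v1 \<^bold>: u2))) v) u"
    unfolding q_map_sweedler by (simp add: counit_p mult_ac)
  also have "\<dots> = sweedler (\<lambda>u1 u2. \<epsilon> u1 * \<phi> (v \<^bold>: u2)) u"
    by (simp only: sweedler_counit_right[OF 1(2)])
  also have "\<dots> = \<phi> (v \<^bold>: u)"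
    by (rule sweedler_counit_left[OF 1(1)])
  finally show ?thesis .
qed

lemma q_comult_form:
  assumes "quadrilinear_form scale \<gamma>"
  shows "(\<Sum>(r, s)\<leftarrow>q_map \<Delta> p d u v. sweedler (\<lambda>r1 r2. sweedler (\<lambda>s1 s2. \<gamma> r2 s1 r1 s2) s) r) =
    sweedler (\<lambda>u1 u2. sweedler (\<lambda>v1 v2. \<Sum>(r, s)\<leftarrow>q_map \<Delta> p d u1 v2.
      \<Sum>(r', s')\<leftarrow>q_map \<Delta> p d u2 v1. \<gamma> r s r' s') v) u"
  using q_comult[of u v] assms unfolding teq4_def
  by (simp add: sweedler_def sum_list_map_concat o_def case_prod_unfold)

text \<open>
  Applying the counit to two of the four legs of the compatibility with the comultiplication
  separates it into three conditions: both operations are coalgebra morphisms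
  \<open>X \<otimes> X\<^sup>c\<^sup>o\<^sup>p \<rightarrow> X\<close>, and they satisfy an exchange law.
\<close>

lemma sweedler_p:
  assumes \<beta>: "bilinear_form scale \<beta>"
  shows "sweedler \<beta> (u \<cdot> v) =
    sweedler (\<lambda>u1 u2. sweedler (\<lambda>v1 v2. \<beta> (u1 \<cdot> v2) (u2 \<cdot> v1)) v) u"
proof -
  \<comment> \<open>The counit on the legs of both elements \<open>r\<close> leaves \<open>\<Delta>(u \<cdot> v)\<close>.\<close>
  define \<gamma> where "\<gamma> r s r' s' = \<epsilon> r * (\<epsilon> r' * \<beta> s s')" for r s r' s'
  have \<gamma>: "quadrilinear_form scale \<gamma>"
    using \<beta> unfolding \<gamma>_def quadrilinear_form_def linear_form_iff bilinear_form_iff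
    by (simp add: algebra_simps)
  have lin: "Vector_Spaces.linear scale (*) (\<lambda>s. c * \<beta> s s')"
    "Vector_Spaces.linear scale (*) (\<lambda>s'. \<beta> s s')"
    "Vector_Spaces.linear scale (*) (\<lambda>s. \<epsilon> s * c)" for c s s'
    using \<beta> by (simp_all add: linear_form_iff bilinear_form_iff algebra_simps)
  have "sweedler (\<lambda>r1 r2. sweedler (\<lambda>s1 s2. \<gamma> r2 s1 r1 s2) s) r = \<epsilon> r * sweedler \<beta> s" for r s
    using sweedler_counit_right[OF lin(3)] by (simp add: \<gamma>_def sweedler_mult_form)
  moreover have "(\<Sum>(r, s)\<leftarrow>q_map \<Delta> p d u1 v2. \<Sum>(r', s')\<leftarrow>q_map \<Delta> p d u2 v1. \<gamma> r s r' s')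
      = \<beta> (u1 \<cdot> v2) (u2 \<cdot> v1)" for u1 u2 v1 v2
  proof -
    have "(\<Sum>(r', s')\<leftarrow>q_map \<Delta> p d u2 v1. \<gamma> r s r' s') = \<epsilon> r * \<beta> s (u2 \<cdot> v1)" for r s
      using q_map_counit_fst[OF lin(2), of s u2 v1]
      by (simp add: \<gamma>_def case_prod_unfold sum_list_const_mult)
    then show ?thesis
      using q_map_counit_fst[OF lin(1)[of 1 "u2 \<cdot> v1"], of u1 v2]
      by (simp add: case_prod_unfold)
  qed
  ultimately show ?thesis
    using q_comult_form[OF \<gamma>, of u v] q_map_counit_fst[OF sweedler_linear[OF \<beta>], of u v]
    by simp
qed

lemma sweedler_d:
  assumes \<beta>: "bilinear_form scale \<beta>"
  shows "sweedler \<beta> (u \<^bold>: v) =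
    sweedler (\<lambda>u1 u2. sweedler (\<lambda>v1 v2. \<beta> (u1 \<^bold>: v2) (u2 \<^bold>: v1)) v) u"
proof -
  \<comment> \<open>The compatibility is used at \<open>v \<otimes> u\<close>, and the first factor carries the opposite
    comultiplication, hence the order \<open>r'\<close>, \<open>r\<close>.\<close>
  define \<gamma> where "\<gamma> r s r' s' = \<epsilon> s * (\<epsilon> s' * \<beta> r' r)" for r s r' s'
  have \<gamma>: "quadrilinear_form scale \<gamma>"
    using \<beta> unfolding \<gamma>_def quadrilinear_form_def linear_form_iff bilinear_form_iff
    by (simp add: algebra_simps)
  have lin: "Vector_Spaces.linear scale (*) (\<lambda>s. c * \<beta> s s')"
    "Vector_Spaces.linear scale (*) (\<lambda>s'. \<beta> s s')"
    "Vector_Spaces.linear scale (*) (\<lambda>s. \<epsilon> s * c)" for c s s'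
    using \<beta> by (simp_all add: linear_form_iff bilinear_form_iff algebra_simps)
  have "sweedler (\<lambda>s1 s2. \<gamma> r2 s1 r1 s2) s = \<epsilon> s * \<beta> r1 r2" for r1 r2 s
    using sweedler_counit_left[OF lin(3)] by (simp add: \<gamma>_def)
  then have "sweedler (\<lambda>r1 r2. sweedler (\<lambda>s1 s2. \<gamma> r2 s1 r1 s2) s) r = \<epsilon> s * sweedler \<beta> r" for r s
    by (simp add: sweedler_mult_form)
  moreover have "(\<Sum>(r, s)\<leftarrow>q_map \<Delta> p d v1 u2. \<Sum>(r', s')\<leftarrow>q_map \<Delta> p d v2 u1. \<gamma> r s r' s')
      = \<beta> (u1 \<^bold>: v2) (u2 \<^bold>: v1)" for u1 u2 v1 v2
  proof -
    have "(\<Sum>(r', s')\<leftarrow>q_map \<Delta> p d v2 u1. \<gamma> r s r' s') = \<epsilon> s * \<beta> (u1 \<^bold>: v2) r" for r s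
      using q_map_counit_snd[OF lin(1)[of 1 r], of v2 u1]
      by (simp add: \<gamma>_def case_prod_unfold sum_list_const_mult)
    then show ?thesis
      using q_map_counit_snd[OF lin(2)[of "u1 \<^bold>: v2"], of v1 u2]
      by (simp add: case_prod_unfold)
  qed
  ultimately show ?thesis
    using q_comult_form[OF \<gamma>, of v u] q_map_counit_snd[OF sweedler_linear[OF \<beta>], of v u]
    by (subst sweedler_swap) simp
qed

lemma q_exchange:
  assumes \<beta>: "bilinear_form scale \<beta>"
  shows "sweedler (\<lambda>u1 u2. sweedler (\<lambda>v1 v2. \<beta> (u1 \<cdot> v2) (v1 \<^bold>: u2)) v) u =
    sweedler (\<lambda>u1 u2. sweedler (\<lambda>v1 v2. \<beta> (u2 \<cdot> v1) (v2 \<^bold>: u1)) v) u"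
proof -
  \<comment> \<open>On the left the two counits undo both comultiplications; on the right they keep one
    factor of each of the two copies.\<close>
  define \<gamma> where "\<gamma> r s r' s' = \<epsilon> s * (\<epsilon> r' * \<beta> s' r)" for r s r' s'
  have \<gamma>: "quadrilinear_form scale \<gamma>"
    using \<beta> unfolding \<gamma>_def quadrilinear_form_def linear_form_iff bilinear_form_iff
    by (simp add: algebra_simps)
  have lin: "Vector_Spaces.linear scale (*) (\<lambda>s. \<beta> s s')"
    "Vector_Spaces.linear scale (*) (\<lambda>s'. \<beta> s s')"
    "Vector_Spaces.linear scale (*) (\<lambda>s. c * \<beta> s s')" for c s s'
    using \<beta> by (simp_all add: linear_form_iff bilinear_form_iff algebra_simps)
  have "sweedler (\<lambda>s1 s2. \<gamma> r2 s1 r1 s2) s = \<epsilon> r1 * \<beta> s r2" for r1 r2 s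
    using sweedler_counit_left[OF lin(3)] by (simp add: \<gamma>_def)
  then have "sweedler (\<lambda>r1 r2. sweedler (\<lambda>s1 s2. \<gamma> r2 s1 r1 s2) s) r = \<beta> s r" for r s
    using sweedler_counit_left[OF lin(2)] by simp
  moreover have "(\<Sum>(r, s)\<leftarrow>q_map \<Delta> p d u1 v2. \<Sum>(r', s')\<leftarrow>q_map \<Delta> p d u2 v1. \<gamma> r s r' s')
      = \<beta> (u2 \<cdot> v1) (v2 \<^bold>: u1)" for u1 u2 v1 v2
  proof -
    have "(\<Sum>(r', s')\<leftarrow>q_map \<Delta> p d u2 v1. \<gamma> r s r' s') = \<epsilon> s * \<beta> (u2 \<cdot> v1) r" for r s
      using q_map_counit_fst[OF lin(1)[of r], of u2 v1]
      by (simp add: \<gamma>_def case_prod_unfold sum_list_const_mult)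
    then show ?thesis
      using q_map_counit_snd[OF lin(2)[of "u2 \<cdot> v1"], of u1 v2]
      by (simp add: case_prod_unfold)
  qed
  ultimately show ?thesis
    using q_comult_form[OF \<gamma>, of u v] by (simp add: q_map_sweedler)
qed

end

section \<open>The monomial basis\<close>

text \<open>
  If the elements \<open>g x\<^sup>m\<close> with \<open>m < n\<close> form a basis, then a function \<open>F\<close> of the index \<open>(g, m)\<close> is a linear
  form, and \<open>u\<close> acts on linear forms by \<open>(u F)(v) = F(v u)\<close>.  The resulting formulas make sense
  without knowing the basis, and they respect the relations; this is what shows that the relations
  do not identify any of the monomials.  Letters outside the group act by zero, which is harmless
  because no relation mentions them.
\<close>

primrec term_act ::
    "('g, 'm) monoid_scheme \<Rightarrow> ('g \<Rightarrow> 'k::field) \<Rightarrow> 'g \<Rightarrow> 'k \<Rightarrow> ('k, 'g) alg_term \<Rightarrow>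
       ('g \<Rightarrow> nat \<Rightarrow> 'k) \<Rightarrow> 'g \<Rightarrow> nat \<Rightarrow> 'k" where
  "term_act G \<chi> a \<alpha> (Const c) = (\<lambda>F g m. c * F g m)"
| "term_act G \<chi> a \<alpha> (Gen h) =
     (\<lambda>F g m. if h \<in> carrier G then \<chi> h ^ m * F (g \<otimes>\<^bsub>G\<^esub> h) m else 0)"
| "term_act G \<chi> a \<alpha> GenX =
     (\<lambda>F g m. if Suc m < mult_order (\<chi> a) then F g (Suc m)
        else \<alpha> * (F (g \<otimes>\<^bsub>G\<^esub> a [^]\<^bsub>G\<^esub> mult_order (\<chi> a)) 0 - F g 0))"
| "term_act G \<chi> a \<alpha> (Add s t) = (\<lambda>F g m. term_act G \<chi> a \<alpha> s F g m + term_act G \<chi> a \<alpha> t F g m)"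
| "term_act G \<chi> a \<alpha> (Mult s t) = (\<lambda>F. term_act G \<chi> a \<alpha> s (term_act G \<chi> a \<alpha> t F))"

locale rank_one_data =
  fixes G :: "('g, 'm) monoid_scheme"
    and \<chi> :: "'g \<Rightarrow> 'k::field"
    and a :: 'g
    and \<alpha> :: 'k
  assumes data: "rank_one_datum G \<chi> a \<alpha>"
begin

sublocale group G
  using data by (simp add: rank_one_datum_def)

abbreviation n :: nat where "n \<equiv> mult_order (\<chi> a)"

abbreviation q :: 'k where "q \<equiv> \<chi> a"

lemma a_carrier [simp]: "a \<in> carrier G"
  using data by (simp add: rank_one_datum_def)

lemma a_central: "g \<in> carrier G \<Longrightarrow> a \<otimes>\<^bsub>G\<^esub> g = g \<otimes>\<^bsub>G\<^esub> a"
  using data by (simp add: rank_one_datum_def)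

lemma n_gt_1: "n > 1"
  using data by (simp add: rank_one_datum_def Let_def)

lemma finite_carrier [simp]: "finite (carrier G)"
  using data by (simp add: rank_one_datum_def)

lemma chi_nonzero: "g \<in> carrier G \<Longrightarrow> \<chi> g \<noteq> 0"
  using data by (simp add: rank_one_datum_def group_character_def)

lemma chi_mult:
  "g \<in> carrier G \<Longrightarrow> h \<in> carrier G \<Longrightarrow> \<chi> (g \<otimes>\<^bsub>G\<^esub> h) = \<chi> g * \<chi> h"
  using data by (simp add: rank_one_datum_def group_character_def)

lemma chi_one: "\<chi> \<one>\<^bsub>G\<^esub> = 1"
  using chi_mult[of "\<one>\<^bsub>G\<^esub>" "\<one>\<^bsub>G\<^esub>"] chi_nonzero[of "\<one>\<^bsub>G\<^esub>"] by simp

lemma chi_pow: "g \<in> carrier G \<Longrightarrow> \<chi> (g [^]\<^bsub>G\<^esub> (i::nat)) = \<chi> g ^ i"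
  by (induction i) (simp_all add: chi_one chi_mult)

lemma q_power_n: "q ^ n = 1"
  and q_power_neq: "0 < i \<Longrightarrow> i < n \<Longrightarrow> q ^ i \<noteq> 1"
proof -
  have "0 < order G \<and> q ^ order G = 1"
    using pow_order_eq_1[of a] chi_pow[of a "order G"] chi_one order_gt_0_iff_finite by simp
  then have "0 < n \<and> q ^ n = 1"
    unfolding mult_order_def by (rule LeastI[where P = "\<lambda>m. 0 < m \<and> q ^ m = 1"])
  then show "q ^ n = 1"
    by simp
  show "q ^ i \<noteq> 1" if "0 < i" "i < n"
    using that not_less_Least[of i "\<lambda>m. 0 < m \<and> q ^ m = 1"] unfolding mult_order_def by blast
qed

lemma a_neq_one: "a \<noteq> \<one>\<^bsub>G\<^esub>"
  using q_power_neq[of 1] n_gt_1 chi_one by auto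

lemma pow_a_central:
  "g \<in> carrier G \<Longrightarrow> a [^]\<^bsub>G\<^esub> (i::nat) \<otimes>\<^bsub>G\<^esub> g = g \<otimes>\<^bsub>G\<^esub> a [^]\<^bsub>G\<^esub> i"
proof (induction i)
  case (Suc i)
  have "a [^]\<^bsub>G\<^esub> Suc i \<otimes>\<^bsub>G\<^esub> g = a [^]\<^bsub>G\<^esub> i \<otimes>\<^bsub>G\<^esub> g \<otimes>\<^bsub>G\<^esub> a"
    using Suc.prems by (simp add: m_assoc a_central)
  then show ?case
    using Suc by (simp add: m_assoc)
qed simp

abbreviation act :: "('k, 'g) alg_term \<Rightarrow> ('g \<Rightarrow> nat \<Rightarrow> 'k) \<Rightarrow> 'g \<Rightarrow> nat \<Rightarrow> 'k" where
  "act \<equiv> term_act G \<chi> a \<alpha>"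

text \<open>
  The relations hold only on indices \<open>(g, m)\<close> with \<open>g\<close> in the group and \<open>m < n\<close>, so functions are
  compared there.
\<close>

definition eq_on_basis :: "('g \<Rightarrow> nat \<Rightarrow> 'k) \<Rightarrow> ('g \<Rightarrow> nat \<Rightarrow> 'k) \<Rightarrow> bool" where
  "eq_on_basis F F' \<longleftrightarrow> (\<forall>g \<in> carrier G. \<forall>m < n. F g m = F' g m)"

lemma act_eq_on_basis: "eq_on_basis F F' \<Longrightarrow> eq_on_basis (act t F) (act t F')"
proof (induction t arbitrary: F F')
  case (Add s t)
  show ?case
    using Add.IH[OF Add.prems] by (simp add: eq_on_basis_def)
qed (use n_gt_1 in \<open>simp_all add: eq_on_basis_def\<close>)

lemma act_add: "act t (\<lambda>g m. F g m + F' g m) = (\<lambda>g m. act t F g m + act t F' g m)"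
  by (induction t arbitrary: F F') (auto intro!: ext simp: algebra_simps)

lemma act_scale: "act t (\<lambda>g m. c * F g m) = (\<lambda>g m. c * act t F g m)"
  by (induction t arbitrary: F) (auto intro!: ext simp: algebra_simps)

text \<open>
  For \<open>j \<le> n\<close> the exponent passes \<open>n\<close> at most once, so that \<open>x\<^sup>n = \<alpha>(a\<^sup>n - 1)\<close> is used at most once.
  The case \<open>j = n\<close> is that relation itself.
\<close>

lemma act_power_GenX:
  assumes "g \<in> carrier G" "m < n" "j \<le> n"
  shows "act (term_power GenX j) F g m =
    (if m + j < n then F g (m + j)
     else \<alpha> * (F (g \<otimes>\<^bsub>G\<^esub> a [^]\<^bsub>G\<^esub> n) (m + j - n) - F g (m + j - n)))"
  using assms
proof (induction j arbitrary: g m)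
  case (Suc j)
  show ?case
  proof (cases "Suc m < n")
    case True
    then show ?thesis
      using Suc.IH[of g "Suc m"] Suc.prems by simp
  next
    case False
    then have "n = Suc m"
      using Suc.prems by simp
    then show ?thesis
      using Suc.IH[of _ 0] Suc.prems by simp
  qed
qed simp

text \<open>
  The only delicate relation is \<open>x h = \<chi>(h) h x\<close> on the indices \<open>(g, n - 1)\<close>: the two sides
  differ by the factor \<open>\<chi>(h)\<^sup>n\<close> in front of a multiple of \<open>\<alpha>(a\<^sup>n - 1)\<close>, and the datum makes this
  factor equal to one or this multiple zero.
\<close>

lemma act_cong:
  assumes "rank_one_cong G \<chi> a \<alpha> s t" and "eq_on_basis F F'"
  shows "eq_on_basis (act s F) (act t F')"
  using assms
proof (induction arbitrary: F F')
  case (cong_refl s)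
  then show ?case
    by (rule act_eq_on_basis)
next
  case (cong_sym s t)
  have "eq_on_basis F' F"
    using cong_sym.prems by (simp add: eq_on_basis_def)
  from cong_sym.IH[OF this] show ?case
    by (simp add: eq_on_basis_def)
next
  case (cong_trans s t u)
  have "eq_on_basis F' F'"
    by (simp add: eq_on_basis_def)
  with cong_trans.IH(1)[OF cong_trans.prems] cong_trans.IH(2) show ?case
    by (simp add: eq_on_basis_def)
next
  case (cong_Add s s' t t')
  show ?case
    using cong_Add.IH(1)[OF cong_Add.prems] cong_Add.IH(2)[OF cong_Add.prems]
    by (simp add: eq_on_basis_def)
next
  case (cong_Mult s s' t t')
  show ?case
    using cong_Mult.IH(1)[OF cong_Mult.IH(2)[OF cong_Mult.prems]] by simp
next
  case (ax_add_assoc s t u)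
  show ?case
    using act_eq_on_basis[OF ax_add_assoc, of s] act_eq_on_basis[OF ax_add_assoc, of t]
      act_eq_on_basis[OF ax_add_assoc, of u]
    by (simp add: eq_on_basis_def algebra_simps)
next
  case (ax_add_comm s t)
  show ?case
    using act_eq_on_basis[OF ax_add_comm, of s] act_eq_on_basis[OF ax_add_comm, of t]
    by (simp add: eq_on_basis_def algebra_simps)
next
  case (ax_add_zero s)
  show ?case
    using act_eq_on_basis[OF ax_add_zero, of s] by (simp add: eq_on_basis_def)
next
  case (ax_add_minus s)
  show ?case
    by (simp add: eq_on_basis_def)
next
  case (ax_mult_assoc s t u)
  show ?case
    using act_eq_on_basis[OF ax_mult_assoc, of "Mult s (Mult t u)"] by (simp add: eq_on_basis_def)
next
  case (ax_one_mult s)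
  show ?case
    using act_eq_on_basis[OF ax_one_mult, of s] by (simp add: eq_on_basis_def)
next
  case (ax_mult_one s)
  show ?case
    using act_eq_on_basis[OF ax_mult_one, of s] by (simp add: eq_on_basis_def)
next
  case (ax_distrib_right s t u)
  show ?case
    using act_eq_on_basis[OF ax_distrib_right, of "Mult (Add s t) u"] by (simp add: eq_on_basis_def)
next
  case (ax_distrib_left s t u)
  show ?case
    using act_eq_on_basis[OF ax_distrib_left, of "Mult s (Add t u)"]
    by (simp add: eq_on_basis_def act_add)
next
  case (ax_const_add c e)
  then show ?case
    by (simp add: eq_on_basis_def algebra_simps)
next
  case (ax_const_mult c e)
  then show ?case
    by (simp add: eq_on_basis_def algebra_simps)
next
  case (ax_const_central s c)
  show ?case
    using act_eq_on_basis[OF ax_const_central, of s] by (simp add: eq_on_basis_def act_scale)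
next
  case (rel_group_mult g h)
  then show ?case
    by (simp add: eq_on_basis_def chi_mult power_mult_distrib m_assoc)
next
  case rel_group_one
  then show ?case
    by (simp add: eq_on_basis_def chi_one)
next
  case (rel_x_power m)
  have "(\<chi> (a [^]\<^bsub>G\<^esub> n)) ^ i = 1" for i
    by (simp add: chi_pow q_power_n)
  with rel_x_power show ?case
    by (simp add: eq_on_basis_def act_power_GenX)
next
  case (rel_x_group h)
  show ?case
    unfolding eq_on_basis_def
  proof (intro ballI allI impI)
    fix g m assume g: "g \<in> carrier G" and m: "m < n"
    show "act (Mult GenX (Gen h)) F g m = act (Mult (Const (\<chi> h)) (Mult (Gen h) GenX)) F' g m"
    proof (cases "Suc m < n")
      case True
      then show ?thesis
        using rel_x_group g by (simp add: eq_on_basis_def)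
    next
      case False
      \<comment> \<open>Here \<open>m = n - 1\<close>, so that \<open>x\<close> wraps around.\<close>
      have *: "\<chi> h * \<chi> h ^ m = \<chi> h ^ n"
        using False m by (metis Suc_lessI power_Suc)
      have **: "\<alpha> = 0 \<or> a [^]\<^bsub>G\<^esub> n = \<one>\<^bsub>G\<^esub> \<or> \<chi> h ^ n = 1"
        using data rel_x_group(1) unfolding rank_one_datum_def Let_def by blast
      have ***: "g \<otimes>\<^bsub>G\<^esub> a [^]\<^bsub>G\<^esub> n \<otimes>\<^bsub>G\<^esub> h = g \<otimes>\<^bsub>G\<^esub> h \<otimes>\<^bsub>G\<^esub> a [^]\<^bsub>G\<^esub> n"
        using g rel_x_group(1) by (simp add: m_assoc pow_a_central a_central)
      have "act (Mult GenX (Gen h)) F g m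
          = \<alpha> * (F' (g \<otimes>\<^bsub>G\<^esub> h \<otimes>\<^bsub>G\<^esub> a [^]\<^bsub>G\<^esub> n) 0 - F' (g \<otimes>\<^bsub>G\<^esub> h) 0)"
        using rel_x_group g False n_gt_1 by (simp add: eq_on_basis_def ***)
      also have "\<dots> = \<chi> h ^ n * (\<alpha> * (F' (g \<otimes>\<^bsub>G\<^esub> h \<otimes>\<^bsub>G\<^esub> a [^]\<^bsub>G\<^esub> n) 0 - F' (g \<otimes>\<^bsub>G\<^esub> h) 0))"
        using ** rel_x_group(1) g by auto
      also have "\<dots> = act (Mult (Const (\<chi> h)) (Mult (Gen h) GenX)) F' g m"
        using rel_x_group False by (simp flip: * add: mult.assoc)
      finally show ?thesis .
    qed
  qed
qed

end

context rank_one_hopf_algebra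
begin

sublocale rank_one_data G \<chi> a \<alpha>
  by unfold_locales (rule datum)

abbreviation tval :: "('k, 'g) alg_term \<Rightarrow> 'h" where "tval \<equiv> term_value scale \<iota> x"

lemma tval_power: "tval (term_power t m) = tval t ^ m"
  by (induction m) simp_all

lemma terms_over_simps [simp]:
  "Const c \<in> terms_over G" "Gen g \<in> terms_over G \<longleftrightarrow> g \<in> carrier G" "GenX \<in> terms_over G"
  "Add s t \<in> terms_over G \<longleftrightarrow> s \<in> terms_over G \<and> t \<in> terms_over G"
  "Mult s t \<in> terms_over G \<longleftrightarrow> s \<in> terms_over G \<and> t \<in> terms_over G"
  by (simp_all add: terms_over_def)

lemma term_power_over [simp]: "t \<in> terms_over G \<Longrightarrow> term_power t m \<in> terms_over G"
  by (induction m) simp_all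

lemma tval_eqI:
  "rank_one_cong G \<chi> a \<alpha> s t \<Longrightarrow> s \<in> terms_over G \<Longrightarrow> t \<in> terms_over G \<Longrightarrow> tval s = tval t"
  using presented by blast

lemma emb_mult:
  "g \<in> carrier G \<Longrightarrow> h \<in> carrier G \<Longrightarrow> \<iota> (g \<otimes>\<^bsub>G\<^esub> h) = \<iota> g * \<iota> h"
  using tval_eqI[OF rel_group_mult, of g h] by simp

lemma emb_one: "\<iota> \<one>\<^bsub>G\<^esub> = 1"
  using tval_eqI[OF rel_group_one] by simp

lemma x_emb: "g \<in> carrier G \<Longrightarrow> x * \<iota> g = scale (\<chi> g) (\<iota> g * x)"
  using tval_eqI[OF rel_x_group, of g] by (simp add: scale_mult_left)

lemma x_power_n: "x ^ n = scale \<alpha> (\<iota> (a [^]\<^bsub>G\<^esub> n) - 1)"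
  using tval_eqI[OF rel_x_power[OF refl]] by (simp add: scale_mult_left tval_power)

lemma x_power_emb: "g \<in> carrier G \<Longrightarrow> x ^ m * \<iota> g = scale (\<chi> g ^ m) (\<iota> g * x ^ m)"
proof (induction m)
  case (Suc m)
  have "x ^ Suc m * \<iota> g = x * (x ^ m * \<iota> g)"
    by (simp add: mult.assoc)
  also have "\<dots> = scale (\<chi> g ^ m) (x * \<iota> g * x ^ m)"
    using Suc by (simp add: scale_mult_right mult.assoc)
  also have "\<dots> = scale (\<chi> g ^ Suc m) (\<iota> g * x ^ Suc m)"
    using Suc.prems by (simp add: x_emb scale_mult_left mult.assoc mult.commute)
  finally show ?case .
qed simp

text \<open>
  The coefficient of \<open>g x\<^sup>m\<close> in \<open>u\<close> is the value at \<open>1\<close> of the result of \<open>u\<close> acting on the indicator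
  function of \<open>(g, m)\<close>.  Any term with value \<open>u\<close> may be used, since two such terms are congruent.
\<close>

definition coord :: "'g \<Rightarrow> nat \<Rightarrow> 'h \<Rightarrow> 'k" where
  "coord g m u = act (SOME t. t \<in> terms_over G \<and> tval t = u)
     (\<lambda>h j. if h = g \<and> j = m then 1 else 0) \<one>\<^bsub>G\<^esub> 0"

lemma coord_tval:
  assumes "t \<in> terms_over G"
  shows "coord g m (tval t) = act t (\<lambda>h j. if h = g \<and> j = m then 1 else 0) \<one>\<^bsub>G\<^esub> 0"
proof -
  define s where "s = (SOME s. s \<in> terms_over G \<and> tval s = tval t)"
  have "s \<in> terms_over G \<and> tval s = tval t"
    unfolding s_def by (rule someI[of _ t]) (simp add: assms)
  then have "rank_one_cong G \<chi> a \<alpha> s t"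
    using presented assms by blast
  from act_cong[OF this, of "\<lambda>h j. if h = g \<and> j = m then 1 else 0"
      "\<lambda>h j. if h = g \<and> j = m then 1 else 0"]
  show ?thesis
    using n_gt_1 by (simp add: coord_def eq_on_basis_def s_def)
qed

lemma coord_linear: "Vector_Spaces.linear scale (*) (coord g m)"
  unfolding linear_form_iff
proof (intro conjI allI)
  fix u v c
  obtain s t where "s \<in> terms_over G" "tval s = u" "t \<in> terms_over G" "tval t = v"
    using generated by meson
  then show "coord g m (u + v) = coord g m u + coord g m v"
    and "coord g m (scale c u) = c * coord g m u"
    using coord_tval[of "Add s t"] coord_tval[of "Mult (Const c) s"] coord_tval[of s]
      coord_tval[of t] by (simp_all add: scale_mult_left)
qed

lemma coord_add [simp]: "coord g m (u + v) = coord g m u + coord g m v"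
  and coord_scale [simp]: "coord g m (scale c u) = c * coord g m u"
  using coord_linear[of g m] by (simp_all add: linear_form_iff)

lemma coord_sum: "coord g m (\<Sum>i\<in>I. f i) = (\<Sum>i\<in>I. coord g m (f i))"
  by (rule linear_form_sum[OF coord_linear])

lemma coord_basis:
  assumes "h \<in> carrier G" "j < n"
  shows "coord g m (\<iota> h * x ^ j) = (if h = g \<and> j = m then 1 else 0)"
  using assms coord_tval[of "Mult (Gen h) (term_power GenX j)" g m] n_gt_1
  by (simp add: tval_power act_power_GenX)

definition basis_span :: "'h set" where
  "basis_span = span ((\<lambda>(g, m). \<iota> g * x ^ m) ` (carrier G \<times> {..<n}))"

lemma basis_in_span: "g \<in> carrier G \<Longrightarrow> m < n \<Longrightarrow> \<iota> g * x ^ m \<in> basis_span"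
  unfolding basis_span_def by (rule span_base) auto

lemma basis_span_step: "u \<in> basis_span \<Longrightarrow> v \<in> basis_span \<Longrightarrow> scale c u + v \<in> basis_span"
  unfolding basis_span_def by (intro span_add span_scale)

text \<open>
  The span of the monomials is a left ideal: a group element permutes the monomials with the
  same exponent, and \<open>x\<close> raises the exponent or, at exponent \<open>n - 1\<close>, returns to exponent \<open>0\<close>.
  As it contains \<open>1\<close>, it is everything.
\<close>

lemma tval_mult_basis_span:
  "t \<in> terms_over G \<Longrightarrow> u \<in> basis_span \<Longrightarrow> tval t * u \<in> basis_span"
proof (induction t arbitrary: u)
  case (Const c)
  then show ?case
    by (simp add: basis_span_def scale_mult_left span_scale)
next
  case (Gen h)
  show ?case
    using \<open>u \<in> basis_span\<close> unfolding basis_span_def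
  proof (induction rule: span_induct_alt)
    case base
    show ?case
      by (simp add: span_zero)
  next
    case (step c v w)
    then obtain g m where "v = \<iota> g * x ^ m" "g \<in> carrier G" "m < n"
      by auto
    then have "\<iota> h * v \<in> basis_span"
      using Gen basis_in_span[of "h \<otimes>\<^bsub>G\<^esub> g" m] by (simp add: emb_mult mult.assoc)
    with step show ?case
      by (simp add: distrib_left scale_mult_right basis_span_step flip: basis_span_def)
  qed
next
  case GenX
  show ?case
    using \<open>u \<in> basis_span\<close> unfolding basis_span_def
  proof (induction rule: span_induct_alt)
    case base
    show ?case
      by (simp add: span_zero)
  next
    case (step c v w)
    then obtain g m where v: "v = \<iota> g * x ^ m" and g: "g \<in> carrier G" and m: "m < n"
      by auto
    have *: "x * v = scale (\<chi> g) (\<iota> g * x ^ Suc m)"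
      using g unfolding v mult.assoc[symmetric] by (simp add: x_emb scale_mult_left mult.assoc)
    have "\<iota> g * x ^ Suc m \<in> basis_span"
    proof (cases "Suc m < n")
      case True
      then show ?thesis
        using g by (rule basis_in_span[rotated])
    next
      case False
      then have "Suc m = n"
        using m by simp
      then have "\<iota> g * x ^ Suc m = scale \<alpha> (\<iota> (g \<otimes>\<^bsub>G\<^esub> a [^]\<^bsub>G\<^esub> n) * x ^ 0 - \<iota> g * x ^ 0)"
        using g by (simp only: x_power_n) (simp add: scale_mult_right emb_mult algebra_simps)
      also have "\<dots> \<in> basis_span"
        using basis_in_span[of "g \<otimes>\<^bsub>G\<^esub> a [^]\<^bsub>G\<^esub> n" 0] basis_in_span[of g 0] g n_gt_1
        unfolding basis_span_def by (intro span_scale span_diff) simp_all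
      finally show ?thesis .
    qed
    with step show ?case
      by (simp add: distrib_left scale_mult_right basis_span_step * flip: basis_span_def)
  qed
next
  case (Add s t)
  then show ?case
    by (simp add: distrib_right) (simp add: basis_span_def span_add)
next
  case (Mult s t)
  then show ?case
    by (simp add: mult.assoc)
qed

lemma basis_span_UNIV: "basis_span = UNIV"
proof (intro equalityI subset_UNIV subsetI)
  fix u
  obtain t where "t \<in> terms_over G" "tval t = u"
    using generated by blast
  moreover have "1 \<in> basis_span"
    using basis_in_span[of "\<one>\<^bsub>G\<^esub>" 0] n_gt_1 by (simp add: emb_one)
  ultimately show "u \<in> basis_span"
    using tval_mult_basis_span[of t 1] by simp
qed

lemma basis_induct [case_names zero add basis]:
  assumes "P 0" and "\<And>c u v. P u \<Longrightarrow> P v \<Longrightarrow> P (scale c u + v)"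
    and "\<And>g m. g \<in> carrier G \<Longrightarrow> m < n \<Longrightarrow> P (\<iota> g * x ^ m)"
  shows "P u"
proof -
  have "u \<in> basis_span"
    by (simp add: basis_span_UNIV)
  then show ?thesis
    unfolding basis_span_def by (induction rule: span_induct_alt) (use assms in auto)
qed

lemma coord_expansion: "(\<Sum>g\<in>carrier G. \<Sum>m<n. scale (coord g m u) (\<iota> g * x ^ m)) = u"
proof (induction u rule: basis_induct)
  case zero
  have "coord g m 0 = 0" for g m
    using coord_scale[of g m 0 0] by simp
  then show ?case
    by simp
next
  case (add c u v)
  have "(\<Sum>g\<in>carrier G. \<Sum>m<n. scale (coord g m (scale c u + v)) (\<iota> g * x ^ m))
      = scale c (\<Sum>g\<in>carrier G. \<Sum>m<n. scale (coord g m u) (\<iota> g * x ^ m))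
        + (\<Sum>g\<in>carrier G. \<Sum>m<n. scale (coord g m v) (\<iota> g * x ^ m))"
    by (simp add: scale_left_distrib sum.distrib scale_sum_right)
  then show ?case
    using add by simp
next
  case (basis h j)
  have "(\<Sum>g\<in>carrier G. \<Sum>m<n. scale (coord g m (\<iota> h * x ^ j)) (\<iota> g * x ^ m))
      = (\<Sum>g\<in>carrier G. \<Sum>m<n. if g = h then if m = j then \<iota> g * x ^ m else 0 else 0)"
    using basis by (intro sum.cong refl) (auto simp: coord_basis)
  also have "\<dots> = (\<Sum>g\<in>carrier G. if g = h then \<Sum>m<n. if m = j then \<iota> g * x ^ m else 0 else 0)"
    by (intro sum.cong refl) auto
  also have "\<dots> = \<iota> h * x ^ j"
    using basis by simp
  finally show ?case .
qed

lemma coord_eqI: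
  assumes "\<And>g m. g \<in> carrier G \<Longrightarrow> m < n \<Longrightarrow> coord g m u = coord g m v"
  shows "u = v"
proof -
  have "u = (\<Sum>g\<in>carrier G. \<Sum>m<n. scale (coord g m u) (\<iota> g * x ^ m))"
    by (simp add: coord_expansion)
  also have "\<dots> = (\<Sum>g\<in>carrier G. \<Sum>m<n. scale (coord g m v) (\<iota> g * x ^ m))"
    using assms by (intro sum.cong refl) simp
  also have "\<dots> = v"
    by (rule coord_expansion)
  finally show ?thesis .
qed

end

section \<open>Comultiplication of the monomials\<close>

text \<open>
  Of the two Pascal rules, this is the one which comes from \<open>\<Delta>(g x\<^sup>m\<^sup>+\<^sup>1) = \<Delta>(g x\<^sup>m) \<Delta>(x)\<close>.  The
  truncated difference \<open>m - i\<close> for \<open>i > m\<close> occurs with the coefficient zero.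
\<close>

fun gauss_binomial :: "'k::field \<Rightarrow> nat \<Rightarrow> nat \<Rightarrow> 'k" where
  "gauss_binomial q m 0 = 1"
| "gauss_binomial q 0 (Suc i) = 0"
| "gauss_binomial q (Suc m) (Suc i) = q ^ (m - i) * gauss_binomial q m i + gauss_binomial q m (Suc i)"

lemma gauss_binomial_eq_0: "m < i \<Longrightarrow> gauss_binomial q m i = 0"
  by (induction q m i rule: gauss_binomial.induct) auto

lemma gauss_binomial_one: "gauss_binomial q m 1 = (\<Sum>k<m. q ^ k)"
  by (induction m) simp_all

context rank_one_hopf_algebra
begin

lemma gauss_binomial_one_nonzero:
  assumes "0 < m" "m < n"
  shows "gauss_binomial q m 1 \<noteq> 0"
proof -
  have "(q - 1) * gauss_binomial q m 1 = q ^ m - 1"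
    unfolding gauss_binomial_one by (rule power_diff_1_eq [symmetric])
  then show ?thesis
    using q_power_neq[OF assms] by auto
qed

lemma sweedler_group:
  "bilinear_form scale \<beta> \<Longrightarrow> g \<in> carrier G \<Longrightarrow> sweedler \<beta> (\<iota> g) = \<beta> (\<iota> g) (\<iota> g)"
  using sweedler_cong[OF comult_group] by simp

lemma sweedler_x: "bilinear_form scale \<beta> \<Longrightarrow> sweedler \<beta> x = \<beta> x (\<iota> a) + \<beta> 1 x"
  using sweedler_cong[OF comult_x] by simp

lemma sweedler_one: "bilinear_form scale \<beta> \<Longrightarrow> sweedler \<beta> 1 = \<beta> 1 1"
  using sweedler_cong[OF comult_one] by simp

text \<open>
  The summand \<open>x \<otimes> a\<close> of \<open>\<Delta>(x)\<close> raises \<open>i\<close>, and moving its \<open>a\<close> past \<open>x\<^sup>m\<^sup>-\<^sup>i\<close> costs the factor \<open>q\<^sup>m\<^sup>-\<^sup>i\<close>;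
  the summand \<open>1 \<otimes> x\<close> keeps \<open>i\<close>.
\<close>

lemma sweedler_basis:
  assumes "bilinear_form scale \<beta>" and g: "g \<in> carrier G"
  shows "sweedler \<beta> (\<iota> g * x ^ m) =
    (\<Sum>i\<le>m. gauss_binomial q m i *
       \<beta> (\<iota> g * x ^ i) (\<iota> (g \<otimes>\<^bsub>G\<^esub> a [^]\<^bsub>G\<^esub> i) * x ^ (m - i)))"
  using assms(1)
proof (induction m arbitrary: \<beta>)
  case 0
  then show ?case
    using g by (simp add: sweedler_group)
next
  case (Suc m)
  note \<beta> = Suc.prems[unfolded bilinear_form_iff]
  let ?T = "\<lambda>i. \<beta> (\<iota> g * x ^ i) (\<iota> (g \<otimes>\<^bsub>G\<^esub> a [^]\<^bsub>G\<^esub> i) * x ^ (Suc m - i))"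
  have bil: "bilinear_form scale (\<lambda>u1 u2. \<beta> (u1 * x) (u2 * \<iota> a) + \<beta> u1 (u2 * x))"
    using \<beta> by (simp add: bilinear_form_iff distrib_right scale_mult_left algebra_simps)
  have x_step: "\<beta> (\<iota> g * x ^ i * x) (\<iota> (g \<otimes>\<^bsub>G\<^esub> a [^]\<^bsub>G\<^esub> i) * x ^ (m - i) * \<iota> a)
      = q ^ (m - i) * ?T (Suc i)" for i
  proof -
    have "\<iota> (g \<otimes>\<^bsub>G\<^esub> a [^]\<^bsub>G\<^esub> i) * x ^ (m - i) * \<iota> a
        = scale (q ^ (m - i)) (\<iota> (g \<otimes>\<^bsub>G\<^esub> a [^]\<^bsub>G\<^esub> Suc i) * x ^ (m - i))"
      using g by (simp add: mult.assoc x_power_emb scale_mult_right emb_mult)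
    then show ?thesis
      using \<beta> by (simp add: mult.assoc power_commutes)
  qed
  have one_step: "\<beta> (\<iota> g * x ^ i) (\<iota> (g \<otimes>\<^bsub>G\<^esub> a [^]\<^bsub>G\<^esub> i) * x ^ (m - i) * x) = ?T i"
    if "i \<le> m" for i
    using that by (simp add: Suc_diff_le mult.assoc power_commutes)
  have "sweedler \<beta> (\<iota> g * x ^ Suc m) = sweedler \<beta> ((\<iota> g * x ^ m) * x)"
    by (simp add: mult.assoc power_commutes)
  also have "\<dots> = sweedler (\<lambda>u1 u2. \<beta> (u1 * x) (u2 * \<iota> a) + \<beta> u1 (u2 * x)) (\<iota> g * x ^ m)"
  proof -
    have "bilinear_form scale (\<lambda>v1 v2. \<beta> (u1 * v1) (u2 * v2))" for u1 u2
      using \<beta> by (simp add: bilinear_form_iff distrib_left scale_mult_right)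
    then show ?thesis
      using sweedler_mult[OF Suc.prems] by (simp add: sweedler_x)
  qed
  also have "\<dots> = (\<Sum>i\<le>m. gauss_binomial q m i * (q ^ (m - i) * ?T (Suc i) + ?T i))"
    unfolding Suc.IH[OF bil] by (intro sum.cong refl) (simp only: x_step one_step atMost_iff)
  also have "\<dots> = (\<Sum>i\<le>m. q ^ (m - i) * gauss_binomial q m i * ?T (Suc i))
      + (\<Sum>i\<le>Suc m. gauss_binomial q m i * ?T i)"
    by (simp add: gauss_binomial_eq_0 algebra_simps sum.distrib)
  also have "(\<Sum>i\<le>Suc m. gauss_binomial q m i * ?T i)
      = ?T 0 + (\<Sum>i\<le>m. gauss_binomial q m (Suc i) * ?T (Suc i))"
    by (subst sum.atMost_Suc_shift) simp
  also have "(\<Sum>i\<le>m. q ^ (m - i) * gauss_binomial q m i * ?T (Suc i))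
      + (?T 0 + (\<Sum>i\<le>m. gauss_binomial q m (Suc i) * ?T (Suc i)))
      = ?T 0 + (\<Sum>i\<le>m. gauss_binomial q (Suc m) (Suc i) * ?T (Suc i))"
    by (simp add: distrib_right sum.distrib)
  also have "\<dots> = (\<Sum>i\<le>Suc m. gauss_binomial q (Suc m) i * ?T i)"
    by (subst sum.atMost_Suc_shift) simp
  finally show ?case .
qed

lemma coord_emb: "h \<in> carrier G \<Longrightarrow> coord g m (\<iota> h) = (if h = g \<and> m = 0 then 1 else 0)"
  using coord_basis[of h 0 g m] n_gt_1 by auto

lemma coord_one: "coord g m 1 = (if g = \<one>\<^bsub>G\<^esub> \<and> m = 0 then 1 else 0)"
  using coord_emb[of "\<one>\<^bsub>G\<^esub>" g m] by (auto simp: emb_one)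

lemma coord_x: "coord g m x = (if g = \<one>\<^bsub>G\<^esub> \<and> m = 1 then 1 else 0)"
  using coord_basis[of "\<one>\<^bsub>G\<^esub>" 1 g m] n_gt_1 by (auto simp: emb_one)

lemma coord_zero [simp]: "coord g m 0 = 0"
  using coord_scale[of g m 0 0] by simp

lemma counit_group:
  assumes "g \<in> carrier G"
  shows "\<epsilon> (\<iota> g) = 1"
proof -
  have "bilinear_form scale (\<lambda>u v. \<epsilon> u * coord g 0 v)"
    by (simp add: bilinear_form_iff algebra_simps)
  from sweedler_group[OF this assms] show ?thesis
    using assms sweedler_counit_left[OF coord_linear, of g 0 "\<iota> g"] by (simp add: coord_emb)
qed

text \<open>The antipode of a grouplike element is its inverse, so \<open>u = S(u) u u = S(u) u = 1\<close>.\<close>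

lemma grouplike_idempotent_eq_one:
  assumes grouplike: "\<And>\<beta>. bilinear_form scale \<beta> \<Longrightarrow> sweedler \<beta> u = \<beta> u u"
    and "\<epsilon> u = 1" and "u * u = u"
  shows "u = 1"
proof -
  have "S u * u = 1"
  proof (rule coord_eqI)
    fix g m
    have S: "S (v + w) = S v + S w" "S (scale c v) = scale c (S v)" for c v w
      using antipode_linear by (simp_all add: linear_op_iff)
    have "bilinear_form scale (\<lambda>v w. coord g m (S v * w))"
      by (simp add: bilinear_form_iff S algebra_simps scale_mult_left scale_mult_right)
    from grouplike[OF this] have "coord g m (S u * u) = coord g m (\<Sum>(u1, u2)\<leftarrow>\<Delta> u. S u1 * u2)"
      by (simp add: sweedler_def linear_form_sum_list[OF coord_linear] o_def case_prod_unfold)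
    then show "coord g m (S u * u) = coord g m 1"
      using antipode_left[of u] \<open>\<epsilon> u = 1\<close> by simp
  qed
  then show ?thesis
    using \<open>u * u = u\<close> by (metis mult.assoc mult_1_left)
qed

end

section \<open>The actions of the generators\<close>

text \<open>
  The part of a Hopf q-brace structure with \<open>x \<cdot> x = x \<^bold>: x = 0\<close> which determines the
  socle.  It is symmetric in the two operations, so that every statement about one of them
  yields the corresponding statement about the other one (under the prefix \<open>swap\<close>).
\<close>

locale rank_one_actions = rank_one_hopf_algebra scale \<Delta> \<epsilon> S G \<chi> a \<alpha> \<iota> x
  for scale :: "'k::field \<Rightarrow> 'h::ring_1 \<Rightarrow> 'h" and \<Delta> \<epsilon> S
    and G :: "('g, 'm) monoid_scheme" and \<chi> a \<alpha> \<iota> x +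
  fixes p :: "'h \<Rightarrow> 'h \<Rightarrow> 'h"  (infixl \<open>\<cdot>\<close> 68)
    and d :: "'h \<Rightarrow> 'h \<Rightarrow> 'h"  (infixl \<open>\<^bold>:\<close> 68)
    and lam :: "'g \<Rightarrow> 'k"
    and \<xi> :: "'g \<Rightarrow> 'k"
  assumes p_bilinear: "bilinear_op scale p"
    and d_bilinear: "bilinear_op scale d"
    and counit_p: "\<epsilon> (u \<cdot> v) = \<epsilon> u * \<epsilon> v"
    and counit_d: "\<epsilon> (u \<^bold>: v) = \<epsilon> u * \<epsilon> v"
    and sweedler_p: "bilinear_form scale \<beta> \<Longrightarrow> sweedler \<beta> (u \<cdot> v) =
      sweedler (\<lambda>u1 u2. sweedler (\<lambda>v1 v2. \<beta> (u1 \<cdot> v2) (u2 \<cdot> v1)) v) u"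
    and sweedler_d: "bilinear_form scale \<beta> \<Longrightarrow> sweedler \<beta> (u \<^bold>: v) =
      sweedler (\<lambda>u1 u2. sweedler (\<lambda>v1 v2. \<beta> (u1 \<^bold>: v2) (u2 \<^bold>: v1)) v) u"
    and exchange: "bilinear_form scale \<beta> \<Longrightarrow>
      sweedler (\<lambda>u1 u2. sweedler (\<lambda>v1 v2. \<beta> (u1 \<cdot> v2) (v1 \<^bold>: u2)) v) u =
      sweedler (\<lambda>u1 u2. sweedler (\<lambda>v1 v2. \<beta> (u2 \<cdot> v1) (v2 \<^bold>: u1)) v) u"
    and p_one: "h \<cdot> 1 = h"
    and p_mult: "h \<cdot> (k * l) = (h \<cdot> l) \<cdot> k"
    and d_one: "h \<^bold>: 1 = h"
    and d_mult: "h \<^bold>: (k * l) = (h \<^bold>: l) \<^bold>: k"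
    and mult_p: "(h * k) \<cdot> l =
      (\<Sum>(k1, k2)\<leftarrow>\<Delta> k. \<Sum>(l1, l2)\<leftarrow>\<Delta> l. (h \<cdot> (l1 \<^bold>: k2)) * (k1 \<cdot> l2))"
    and mult_d: "(h * k) \<^bold>: l =
      (\<Sum>(k1, k2)\<leftarrow>\<Delta> k. \<Sum>(l1, l2)\<leftarrow>\<Delta> l. (h \<^bold>: (l1 \<cdot> k2)) * (k1 \<^bold>: l2))"
    and p_x_x: "x \<cdot> x = 0"
    and d_x_x: "x \<^bold>: x = 0"
    and lam_character: "group_character G lam"
    and p_x_group: "g \<in> carrier G \<Longrightarrow> x \<cdot> \<iota> g = scale (lam g) x"
    and xi_character: "group_character G \<xi>"
    and d_x_group: "g \<in> carrier G \<Longrightarrow> x \<^bold>: \<iota> g = scale (\<xi> g) x"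

sublocale rank_one_actions \<subseteq> swap: rank_one_actions scale \<Delta> \<epsilon> S G \<chi> a \<alpha> \<iota> x d p \<xi> lam
proof unfold_locales
  fix \<beta> u v
  assume "bilinear_form scale \<beta>"
  then have "bilinear_form scale (\<lambda>r s. \<beta> s r)"
    by (simp add: bilinear_form_iff)
  from exchange[OF this, of u v]
  show "sweedler (\<lambda>u1 u2. sweedler (\<lambda>v1 v2. \<beta> (u1 \<^bold>: v2) (v1 \<cdot> u2)) v) u =
      sweedler (\<lambda>u1 u2. sweedler (\<lambda>v1 v2. \<beta> (u2 \<^bold>: v1) (v2 \<cdot> u1)) v) u"
    by (subst (1 2) sweedler_swap) simp
qed (fact p_bilinear d_bilinear counit_p counit_d sweedler_p sweedler_d p_one p_mult d_one d_mult
    mult_p mult_d p_x_x d_x_x lam_character p_x_group xi_character d_x_group)+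

context rank_one_actions
begin

lemma p_linear [simp]:
  "(u + u') \<cdot> v = u \<cdot> v + u' \<cdot> v" "scale c u \<cdot> v = scale c (u \<cdot> v)"
  "u \<cdot> (v + v') = u \<cdot> v + u \<cdot> v'" "u \<cdot> scale c v = scale c (u \<cdot> v)"
  using p_bilinear by (simp_all add: bilinear_op_iff)

lemma p_zero [simp]: "0 \<cdot> v = 0" "u \<cdot> 0 = 0"
  using p_linear(2)[of 0 0 v] p_linear(4)[of u 0 0] by simp_all

end

context rank_one_actions
begin

lemma lam_nonzero: "g \<in> carrier G \<Longrightarrow> lam g \<noteq> 0"
  and lam_mult: "g \<in> carrier G \<Longrightarrow> h \<in> carrier G \<Longrightarrow> lam (g \<otimes>\<^bsub>G\<^esub> h) = lam g * lam h"
  using lam_character by (simp_all add: group_character_def)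

lemma mult_p_form:
  assumes "Vector_Spaces.linear scale (*) \<phi>"
  shows "\<phi> ((h * k) \<cdot> l) =
    sweedler (\<lambda>k1 k2. sweedler (\<lambda>l1 l2. \<phi> ((h \<cdot> (l1 \<^bold>: k2)) * (k1 \<cdot> l2))) l) k"
  unfolding mult_p
  by (simp add: sweedler_def linear_form_sum_list[OF assms] o_def case_prod_unfold)

lemmas sweedler_generator =
  sweedler_group sweedler_x sweedler_one sweedler_scale

text \<open>
  Reading \<open>1 \<cdot> l\<close> as \<open>1 1 \<cdot> l\<close> shows that \<open>l \<mapsto> 1 \<cdot> l\<close> is idempotent for the convolution product.
  On a group element its value is therefore an idempotent grouplike.
\<close>

lemma one_p_group:
  assumes g: "g \<in> carrier G"
  shows "1 \<cdot> \<iota> g = 1"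
proof (rule grouplike_idempotent_eq_one)
  show "sweedler \<beta> (1 \<cdot> \<iota> g) = \<beta> (1 \<cdot> \<iota> g) (1 \<cdot> \<iota> g)" if "bilinear_form scale \<beta>" for \<beta>
    using that unfolding sweedler_p[OF that]
    by (simp add: sweedler_generator g bilinear_form_iff)
  show "\<epsilon> (1 \<cdot> \<iota> g) = 1"
    by (simp add: counit_p counit_one counit_group g)
  show "(1 \<cdot> \<iota> g) * (1 \<cdot> \<iota> g) = 1 \<cdot> \<iota> g"
  proof (rule coord_eqI)
    fix h m
    show "coord h m ((1 \<cdot> \<iota> g) * (1 \<cdot> \<iota> g)) = coord h m (1 \<cdot> \<iota> g)"
      using mult_p_form[OF coord_linear, of h m 1 1 "\<iota> g"]
      by (simp add: sweedler_generator g bilinear_form_iff algebra_simps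
          scale_mult_left scale_mult_right d_one)
  qed
qed

text \<open>The same reading gives \<open>1 \<cdot> x = (1 \<cdot> x) (1 \<cdot> a) + 1 (1 \<cdot> x) = 1 \<cdot> x + 1 \<cdot> x\<close>.\<close>

lemma one_p_x: "1 \<cdot> x = 0"
proof (rule coord_eqI)
  fix g m
  have "(2 :: 'k) \<noteq> 1"
    by (metis add_cancel_right_right one_add_one one_neq_zero)
  then show "coord g m (1 \<cdot> x) = coord g m 0"
    using mult_p_form[OF coord_linear, of g m 1 1 x]
    by (simp add: sweedler_generator bilinear_form_iff algebra_simps
        scale_mult_left scale_mult_right d_one p_one one_p_group)
qed

text \<open>
  The comultiplication of \<open>x \<cdot> g\<close> is \<open>\<lambda>(g) (x \<otimes> a \<cdot> g + 1 \<otimes> x)\<close>, because \<open>\<cdot>\<close> is a coalgebra morphism, and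
  \<open>\<lambda>(g) (x \<otimes> a + 1 \<otimes> x)\<close>, because \<open>x \<cdot> g = \<lambda>(g) x\<close>.
\<close>

lemma a_p_group:
  assumes g: "g \<in> carrier G"
  shows "\<iota> a \<cdot> \<iota> g = \<iota> a"
proof (rule coord_eqI)
  fix h m
  have \<beta>: "bilinear_form scale (\<lambda>u v. coord \<one>\<^bsub>G\<^esub> 1 u * coord h m v)"
    by (simp add: bilinear_form_iff algebra_simps)
  show "coord h m (\<iota> a \<cdot> \<iota> g) = coord h m (\<iota> a)"
    using sweedler_p[OF \<beta>, of x "\<iota> g"] lam_nonzero[OF g]
    by (simp add: sweedler_generator g bilinear_form_iff algebra_simps p_x_group one_p_group
        coord_x coord_one)
qed

text \<open>
  In \<open>\<lambda>(g) x \<otimes> (g \<^bold>: a - g) = (a - 1) \<otimes> (g \<^bold>: x)\<close> the elements \<open>x\<close> and \<open>a - 1\<close> are linearly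
  independent, so both tensors vanish: this is the source of \<open>g \<^bold>: a = g\<close> and \<open>g \<^bold>: x = 0\<close>.
\<close>

lemma exchange_x_group:
  assumes \<beta>: "bilinear_form scale \<beta>" and g: "g \<in> carrier G"
  shows "lam g * \<beta> x (\<iota> g \<^bold>: \<iota> a) + \<beta> 1 (\<iota> g \<^bold>: x) =
    \<beta> (\<iota> a) (\<iota> g \<^bold>: x) + lam g * \<beta> x (\<iota> g)"
  using exchange[OF \<beta>, of "\<iota> g" x] \<beta> g
  by (simp add: sweedler_generator bilinear_form_iff p_x_group one_p_group a_p_group d_one)

lemma group_d_a:
  assumes g: "g \<in> carrier G"
  shows "\<iota> g \<^bold>: \<iota> a = \<iota> g"
proof (rule coord_eqI)
  fix h m
  have "bilinear_form scale (\<lambda>u v. coord \<one>\<^bsub>G\<^esub> 1 u * coord h m v)"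
    by (simp add: bilinear_form_iff algebra_simps)
  from exchange_x_group[OF this g] show "coord h m (\<iota> g \<^bold>: \<iota> a) = coord h m (\<iota> g)"
    using lam_nonzero[OF g] by (simp add: coord_x coord_one coord_emb)
qed

lemma group_d_x:
  assumes g: "g \<in> carrier G"
  shows "\<iota> g \<^bold>: x = 0"
proof (rule coord_eqI)
  fix h m
  have "bilinear_form scale (\<lambda>u v. coord \<one>\<^bsub>G\<^esub> 0 u * coord h m v)"
    by (simp add: bilinear_form_iff algebra_simps)
  from exchange_x_group[OF this g] show "coord h m (\<iota> g \<^bold>: x) = coord h m 0"
    using a_neq_one by (simp add: coord_x coord_one coord_emb)
qed

end

context rank_one_actions
begin

lemmas group_p_a = swap.group_d_a
lemmas group_p_x = swap.group_d_x

text \<open>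
  On \<open>x \<otimes> x\<close> all terms of the exchange law vanish except for \<open>(x \<cdot> a) \<otimes> (x \<^bold>: a)\<close> on one side
  and \<open>x \<otimes> x\<close> on the other side.
\<close>

lemma lam_xi_a: "lam a * \<xi> a = 1"
proof -
  have \<beta>: "bilinear_form scale (\<lambda>u v. coord \<one>\<^bsub>G\<^esub> 1 u * coord \<one>\<^bsub>G\<^esub> 1 v)"
    by (simp add: bilinear_form_iff algebra_simps)
  show ?thesis
    using exchange[OF \<beta>, of x x]
    by (simp add: sweedler_generator bilinear_form_iff algebra_simps p_x_group d_x_group p_x_x d_x_x
        p_one d_one one_p_x swap.one_p_x group_p_x coord_x)
qed

lemma mult_x_p_group:
  assumes g: "g \<in> carrier G"
  shows "(v * x) \<cdot> \<iota> g = scale (lam g) ((v \<cdot> \<iota> g) * x)"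
proof (rule coord_eqI)
  fix h m
  show "coord h m ((v * x) \<cdot> \<iota> g) = coord h m (scale (lam g) ((v \<cdot> \<iota> g) * x))"
    using mult_p_form[OF coord_linear, of h m v x "\<iota> g"]
    by (simp add: sweedler_generator g bilinear_form_iff algebra_simps scale_mult_left
        scale_mult_right p_x_group group_d_a group_d_x)
qed

lemma mult_x_p_x: "(v * x) \<cdot> x = scale (\<xi> a * lam a) ((v \<cdot> x) * x)"
proof (rule coord_eqI)
  fix h m
  show "coord h m ((v * x) \<cdot> x) = coord h m (scale (\<xi> a * lam a) ((v \<cdot> x) * x))"
    using mult_p_form[OF coord_linear, of h m v x x]
    by (simp add: sweedler_generator bilinear_form_iff algebra_simps scale_mult_left
        scale_mult_right p_x_group d_x_group p_x_x d_x_x one_p_x swap.one_p_x)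
qed

text \<open>
  The group elements are killed by \<open>x\<close>, and the vectors killed by \<open>x\<close> are closed under right
  multiplication by \<open>x\<close>.
\<close>

lemma p_x: "v \<cdot> x = 0"
proof (induction v rule: basis_induct)
  case (basis g m)
  have "(\<iota> g * x ^ m) \<cdot> x = 0" for m
  proof (induction m)
    case 0
    then show ?case
      using basis by (simp add: group_p_x)
  next
    case (Suc m)
    have "\<iota> g * x ^ Suc m = (\<iota> g * x ^ m) * x"
      by (simp add: mult.assoc power_commutes)
    then show ?case
      using Suc by (simp only: mult_x_p_x) simp
  qed
  then show ?case .
qed simp_all

lemma p_basis: "v \<cdot> (\<iota> g * x ^ j) = (if j = 0 then v \<cdot> \<iota> g else 0)"
proof (cases j)
  case (Suc i)
  have "v \<cdot> x ^ Suc i = (v \<cdot> x) \<cdot> x ^ i"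
    by (simp only: power_Suc2 p_mult)
  then show ?thesis
    using Suc by (simp add: p_mult p_x)
qed simp

lemma basis_p_group:
  assumes "g \<in> carrier G"
  shows "(\<iota> h * x ^ j) \<cdot> \<iota> g = scale (lam g ^ j) ((\<iota> h \<cdot> \<iota> g) * x ^ j)"
proof (induction j)
  case (Suc j)
  have "(\<iota> h * x ^ Suc j) \<cdot> \<iota> g = ((\<iota> h * x ^ j) * x) \<cdot> \<iota> g"
    by (simp add: mult.assoc power_commutes)
  also have "\<dots> = scale (lam g ^ Suc j) ((\<iota> h \<cdot> \<iota> g) * x ^ Suc j)"
    unfolding mult_x_p_group[OF assms] Suc
    by (simp add: scale_mult_left mult.assoc power_commutes)
  finally show ?case .
qed simp

text \<open>
  The action of a group element on \<open>h x\<^sup>j\<close> is determined by its actions on \<open>h\<close> and on \<open>x\<close>.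
\<close>

lemma p_group_trivial_iff:
  assumes g: "g \<in> carrier G"
  shows "(\<forall>v. v \<cdot> \<iota> g = v) \<longleftrightarrow> (\<forall>k \<in> carrier G. \<iota> k \<cdot> \<iota> g = \<iota> k) \<and> lam g = 1"
proof (intro iffI conjI allI ballI)
  assume triv: "\<forall>v. v \<cdot> \<iota> g = v"
  then have "coord \<one>\<^bsub>G\<^esub> 1 (scale (lam g) x) = coord \<one>\<^bsub>G\<^esub> 1 x"
    by (simp flip: p_x_group[OF g])
  then show "lam g = 1"
    by (simp add: coord_x)
next
  fix v
  assume *: "(\<forall>k \<in> carrier G. \<iota> k \<cdot> \<iota> g = \<iota> k) \<and> lam g = 1"
  show "v \<cdot> \<iota> g = v"
    by (induction v rule: basis_induct) (simp_all add: basis_p_group g *)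
qed simp

lemma p_pow_a:
  assumes "lam a = 1"
  shows "v \<cdot> \<iota> (a [^]\<^bsub>G\<^esub> (i::nat)) = v"
proof (induction i)
  case (Suc i)
  have "v \<cdot> \<iota> a = v"
    using p_group_trivial_iff[of a] group_p_a assms by simp
  then show ?case
    using Suc by (simp add: emb_mult p_mult)
qed (simp add: emb_one p_one)

text \<open>
  The side conditions for evaluating \<open>\<beta> u\<^sub>(\<^sub>1\<^sub>) (v \<cdot> u\<^sub>(\<^sub>2\<^sub>)) u\<^sub>(\<^sub>3\<^sub>)\<close> one comultiplication at a time.
\<close>

lemma trilinear_split:
  assumes "trilinear_form scale \<beta>"
  shows "bilinear_form scale (\<lambda>u1 u2. \<beta> u1 v u2)"
    and "bilinear_form scale (\<lambda>u2 u3. \<beta> u1 (v \<cdot> u2) u3)"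
    and "bilinear_form scale (\<lambda>u1 u'. sweedler (\<lambda>u2 u3. \<beta> u1 (v \<cdot> u2) u3) u')"
proof -
  note * = assms[unfolded trilinear_form_iff]
  show "bilinear_form scale (\<lambda>u1 u2. \<beta> u1 v u2)"
    using * by (simp add: bilinear_form_iff)
  show **: "bilinear_form scale (\<lambda>u2 u3. \<beta> u1 (v \<cdot> u2) u3)" for u1
    using * by (simp add: bilinear_form_iff)
  have "\<beta> (u + u') w = (\<lambda>z. \<beta> u w z + \<beta> u' w z)" "\<beta> (scale c u) w = (\<lambda>z. c * \<beta> u w z)"
    for u u' w c
    using * by auto
  then show "bilinear_form scale (\<lambda>u1 u'. sweedler (\<lambda>u2 u3. \<beta> u1 (v \<cdot> u2) u3) u')"
    using sweedler_linear[OF **, unfolded linear_form_iff]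
    by (simp add: bilinear_form_iff sweedler_add_form sweedler_mult_form)
qed

text \<open>Since \<open>x\<close> acts by zero, only the terms of \<open>\<Delta>\<^sup>2(g x\<^sup>m)\<close> with a group element in the
  middle contribute.\<close>

lemma sweedler_middle_p:
  assumes \<beta>: "trilinear_form scale \<beta>" and g: "g \<in> carrier G"
  shows "sweedler (\<lambda>u1 u'. sweedler (\<lambda>u2 u3. \<beta> u1 (v \<cdot> u2) u3) u') (\<iota> g * x ^ m) =
    (\<Sum>i\<le>m. gauss_binomial q m i * \<beta> (\<iota> g * x ^ i) (v \<cdot> \<iota> (g \<otimes>\<^bsub>G\<^esub> a [^]\<^bsub>G\<^esub> i))
       (\<iota> (g \<otimes>\<^bsub>G\<^esub> a [^]\<^bsub>G\<^esub> i) * x ^ (m - i)))"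
proof -
  have zero: "\<beta> u 0 w = 0" for u w
    using \<beta> unfolding trilinear_form_iff by (metis mult_zero_left scale_zero_left)
  have "sweedler (\<lambda>u2 u3. \<beta> u1 (v \<cdot> u2) u3) (\<iota> h * x ^ j) = \<beta> u1 (v \<cdot> \<iota> h) (\<iota> h * x ^ j)"
    if "h \<in> carrier G" for h j u1
  proof -
    have "sweedler (\<lambda>u2 u3. \<beta> u1 (v \<cdot> u2) u3) (\<iota> h * x ^ j)
        = (\<Sum>i\<le>j. if i = 0 then \<beta> u1 (v \<cdot> \<iota> h) (\<iota> h * x ^ j) else 0)"
      unfolding sweedler_basis[OF trilinear_split(2)[OF \<beta>] that]
      by (intro sum.cong refl) (use that in \<open>simp add: p_basis zero\<close>)
    then show ?thesis
      by simp
  qed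
  then show ?thesis
    unfolding sweedler_basis[OF trilinear_split(3)[OF \<beta>] g] using g by simp
qed

text \<open>
  The tensors \<open>h x\<^sup>i \<otimes> h a\<^sup>i x\<^sup>k\<^sup>-\<^sup>i\<close> for the various \<open>h\<close>, \<open>i\<close> and \<open>k\<close> are distinct elements of a
  basis, so the outer legs of the tensor with indices \<open>(g, s, m)\<close> single out one term.
\<close>

lemma extract_coefficient:
  assumes "g \<in> carrier G" "m < n" "s \<le> m"
  shows "(\<Sum>h\<in>carrier G. \<Sum>k<n. coord h k u * (\<Sum>i\<le>k. gauss_binomial q k i *
      (coord g s (\<iota> h * x ^ i) * W h i *
       coord (g \<otimes>\<^bsub>G\<^esub> a [^]\<^bsub>G\<^esub> s) (m - s) (\<iota> (h \<otimes>\<^bsub>G\<^esub> a [^]\<^bsub>G\<^esub> i) * x ^ (k - i)))))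
    = coord g m u * gauss_binomial q m s * W g s"
proof -
  let ?c = "\<lambda>h k i. coord g s (\<iota> h * x ^ i) * W h i *
       coord (g \<otimes>\<^bsub>G\<^esub> a [^]\<^bsub>G\<^esub> s) (m - s) (\<iota> (h \<otimes>\<^bsub>G\<^esub> a [^]\<^bsub>G\<^esub> i) * x ^ (k - i))"
  have "(\<Sum>i\<le>k. gauss_binomial q k i * ?c h k i)
      = (if h = g then if k = m then gauss_binomial q m s * W g s else 0 else 0)"
    if "h \<in> carrier G" "k < n" for h k
  proof -
    have "(\<Sum>i\<le>k. gauss_binomial q k i * ?c h k i)
        = (\<Sum>i\<le>k. if i = s then if h = g \<and> k = m then gauss_binomial q m s * W g s else 0 else 0)"
      using that assms by (intro sum.cong refl) (auto simp: coord_basis)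
    also have "\<dots> = (if h = g then if k = m then gauss_binomial q m s * W g s else 0 else 0)"
      using assms by (simp add: sum.delta)
    finally show ?thesis .
  qed
  then have "(\<Sum>h\<in>carrier G. \<Sum>k<n. coord h k u * (\<Sum>i\<le>k. gauss_binomial q k i * ?c h k i))
      = (\<Sum>h\<in>carrier G. \<Sum>k<n. if h = g then
           if k = m then coord g m u * gauss_binomial q m s * W g s else 0 else 0)"
    by (intro sum.cong refl) auto
  also have "\<dots> = (\<Sum>h\<in>carrier G. if h = g then \<Sum>k<n.
           if k = m then coord g m u * gauss_binomial q m s * W g s else 0 else 0)"
    by (intro sum.cong refl) auto
  also have "\<dots> = coord g m u * gauss_binomial q m s * W g s"
    using assms by simp
  finally show ?thesis .
qed

lemma linear_form_expansion:
  assumes "Vector_Spaces.linear scale (*) \<phi>"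
  shows "\<phi> u = (\<Sum>g\<in>carrier G. \<Sum>m<n. coord g m u * \<phi> (\<iota> g * x ^ m))"
proof -
  have "\<phi> u = \<phi> (\<Sum>g\<in>carrier G. \<Sum>m<n. scale (coord g m u) (\<iota> g * x ^ m))"
    by (simp add: coord_expansion)
  then show ?thesis
    using assms by (simp add: linear_form_sum linear_form_iff)
qed

lemma teq3_iff_sweedler:
  "teq3 scale [(u1, v \<cdot> u2, u3). (u1, u') \<leftarrow> \<Delta> u, (u2, u3) \<leftarrow> \<Delta> u'] [(u1, v, u2). (u1, u2) \<leftarrow> \<Delta> u]
   \<longleftrightarrow> (\<forall>\<beta>. trilinear_form scale \<beta> \<longrightarrow>
      sweedler (\<lambda>u1 u'. sweedler (\<lambda>u2 u3. \<beta> u1 (v \<cdot> u2) u3) u') u = sweedler (\<lambda>u1 u2. \<beta> u1 v u2) u)"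
  by (simp add: teq3_def sweedler_def sum_list_map_concat o_def case_prod_unfold)

text \<open>
  The outer legs of \<open>\<Delta>\<^sup>2(u)\<close> separate the terms, so the condition says that \<open>g a\<^sup>s\<close> acts trivially
  whenever \<open>g x\<^sup>m\<close> occurs in \<open>u\<close> and the coefficient of \<open>g x\<^sup>s \<otimes> g a\<^sup>s x\<^sup>m\<^sup>-\<^sup>s\<close> in \<open>\<Delta>(g x\<^sup>m)\<close> is
  nonzero.  The cases \<open>s = 0\<close> and \<open>s = 1\<close> already yield all that is needed: together they make
  \<open>a\<close> act trivially, and then every \<open>g a\<^sup>s\<close> does.
\<close>

lemma p_socle_iff:
  "(\<forall>v. teq3 scale [(u1, v \<cdot> u2, u3). (u1, u') \<leftarrow> \<Delta> u, (u2, u3) \<leftarrow> \<Delta> u']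
      [(u1, v, u2). (u1, u2) \<leftarrow> \<Delta> u])
   \<longleftrightarrow> (\<forall>g\<in>carrier G. \<forall>m<n. coord g m u \<noteq> 0 \<longrightarrow>
      (\<forall>v. v \<cdot> \<iota> g = v) \<and> (m = 0 \<or> lam a = 1))"
  (is "?L \<longleftrightarrow> ?R")
proof
  assume ?L
  show ?R
  proof (intro ballI allI impI)
    fix g m
    assume g: "g \<in> carrier G" and m: "m < n" and nz: "coord g m u \<noteq> 0"
    have fixed: "v \<cdot> \<iota> (g \<otimes>\<^bsub>G\<^esub> a [^]\<^bsub>G\<^esub> s) = v" if s: "s \<le> m" "gauss_binomial q m s \<noteq> 0"
      for s :: nat and v
    proof (rule coord_eqI)
      fix h j
      define \<beta> where
        "\<beta> u1 u2 u3 = coord g s u1 * coord h j u2 * coord (g \<otimes>\<^bsub>G\<^esub> a [^]\<^bsub>G\<^esub> s) (m - s) u3"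
        for u1 u2 u3
      have \<beta>: "trilinear_form scale \<beta>"
        by (simp add: \<beta>_def trilinear_form_iff algebra_simps)
      have "sweedler (\<lambda>u1 u'. sweedler (\<lambda>u2 u3. \<beta> u1 (v \<cdot> u2) u3) u') u
          = coord g m u * gauss_binomial q m s * coord h j (v \<cdot> \<iota> (g \<otimes>\<^bsub>G\<^esub> a [^]\<^bsub>G\<^esub> s))"
        unfolding linear_form_expansion[OF sweedler_linear[OF trilinear_split(3)[OF \<beta>]], of v u]
        using extract_coefficient[OF g m s(1), of u "\<lambda>h' i. coord h j (v \<cdot> \<iota> (h' \<otimes>\<^bsub>G\<^esub> a [^]\<^bsub>G\<^esub> i))"]
        by (simp add: sweedler_middle_p[OF \<beta>]) (simp add: \<beta>_def)
      moreover have "sweedler (\<lambda>u1 u2. \<beta> u1 v u2) u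
          = coord g m u * gauss_binomial q m s * coord h j v"
        unfolding linear_form_expansion[OF sweedler_linear[OF trilinear_split(1)[OF \<beta>]], of v u]
        using extract_coefficient[OF g m s(1), of u "\<lambda>h' i. coord h j v"]
        by (simp add: sweedler_basis[OF trilinear_split(1)[OF \<beta>]]) (simp add: \<beta>_def)
      ultimately show "coord h j (v \<cdot> \<iota> (g \<otimes>\<^bsub>G\<^esub> a [^]\<^bsub>G\<^esub> s)) = coord h j v"
        using \<open>?L\<close>[unfolded teq3_iff_sweedler] \<beta> nz s(2) by auto
    qed
    have g_triv: "\<forall>v. v \<cdot> \<iota> g = v"
      using fixed[of 0] g by simp
    moreover have "lam a = 1" if "m \<noteq> 0"
    proof -
      have "\<forall>v. v \<cdot> \<iota> (g \<otimes>\<^bsub>G\<^esub> a) = v"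
        using fixed[of 1] gauss_binomial_one_nonzero[of m] that m by simp
      then have "lam (g \<otimes>\<^bsub>G\<^esub> a) = 1" "lam g = 1"
        using p_group_trivial_iff[of "g \<otimes>\<^bsub>G\<^esub> a"] p_group_trivial_iff[of g] g g_triv by simp_all
      then show ?thesis
        using g by (simp add: lam_mult)
    qed
    ultimately show "(\<forall>v. v \<cdot> \<iota> g = v) \<and> (m = 0 \<or> lam a = 1)"
      by blast
  qed
next
  assume R: ?R
  show ?L
    unfolding teq3_iff_sweedler
  proof (intro allI impI)
    fix v \<beta>
    assume \<beta>: "trilinear_form scale \<beta>"
    let ?l = "sweedler (\<lambda>u1 u'. sweedler (\<lambda>u2 u3. \<beta> u1 (v \<cdot> u2) u3) u')"
    let ?r = "sweedler (\<lambda>u1 u2. \<beta> u1 v u2)"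
    have "coord g m u * ?l (\<iota> g * x ^ m) = coord g m u * ?r (\<iota> g * x ^ m)"
      if g: "g \<in> carrier G" and m: "m < n" for g m
    proof (cases "coord g m u = 0")
      case False
      have "v \<cdot> \<iota> (g \<otimes>\<^bsub>G\<^esub> a [^]\<^bsub>G\<^esub> i) = v" if "i \<le> m" for i
      proof (cases "m = 0")
        case True
        then show ?thesis
          using R g m False that by simp
      next
        case m0: False
        then have "lam a = 1" "\<And>v. v \<cdot> \<iota> g = v"
          using R g m False by blast+
        then show ?thesis
          using g by (simp add: emb_mult p_mult p_pow_a)
      qed
      then show ?thesis
        by (simp add: sweedler_middle_p[OF \<beta> g] sweedler_basis[OF trilinear_split(1)[OF \<beta>] g])
    qed simp
    then show "?l u = ?r u"
      unfolding linear_form_expansion[OF sweedler_linear[OF trilinear_split(3)[OF \<beta>]], of v u]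
        linear_form_expansion[OF sweedler_linear[OF trilinear_split(1)[OF \<beta>]], of v u]
      by (intro sum.cong refl) (simp del: mult_cancel_left)
  qed
qed

end

section \<open>The socle\<close>

context rank_one_actions
begin

definition trivial_group_elements :: "'g set" where
  "trivial_group_elements = {h \<in> group_Socle G \<iota> p d. lam h = 1 \<and> \<xi> h = 1}"

text \<open>
  The conditions on \<open>\<lambda>(a)\<close> and \<open>\<xi>(a)\<close> coincide because \<open>\<lambda>(a) \<xi>(a) = 1\<close>.
\<close>

lemma socle_iff:
  "u \<in> Socle scale \<Delta> p d \<longleftrightarrow> (\<forall>g\<in>carrier G. \<forall>m<n. coord g m u \<noteq> 0 \<longrightarrow>
     g \<in> trivial_group_elements \<and> (m = 0 \<or> lam a = 1))"
proof -
  define P where "P g \<longleftrightarrow> (\<forall>v. v \<cdot> \<iota> g = v)" for g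
  define Q where "Q g \<longleftrightarrow> (\<forall>v. v \<^bold>: \<iota> g = v)" for g
  have "g \<in> trivial_group_elements \<longleftrightarrow> P g \<and> Q g" if "g \<in> carrier G" for g
    unfolding P_def Q_def p_group_trivial_iff[OF that] swap.p_group_trivial_iff[OF that]
    using that by (auto simp: trivial_group_elements_def group_Socle_def)
  moreover have "\<xi> a = 1 \<longleftrightarrow> lam a = 1"
    using lam_xi_a by auto
  moreover have "u \<in> Socle scale \<Delta> p d \<longleftrightarrow>
      (\<forall>v. teq3 scale [(u1, v \<cdot> u2, u3). (u1, u') \<leftarrow> \<Delta> u, (u2, u3) \<leftarrow> \<Delta> u']
        [(u1, v, u2). (u1, u2) \<leftarrow> \<Delta> u]) \<and>
      (\<forall>v. teq3 scale [(u1, v \<^bold>: u2, u3). (u1, u') \<leftarrow> \<Delta> u, (u2, u3) \<leftarrow> \<Delta> u']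
        [(u1, v, u2). (u1, u2) \<leftarrow> \<Delta> u])"
    unfolding Socle_def by blast
  ultimately show ?thesis
    unfolding p_socle_iff swap.p_socle_iff P_def[symmetric] Q_def[symmetric] by blast
qed

lemma trivial_group_elements_carrier: "trivial_group_elements \<subseteq> carrier G"
  by (auto simp: trivial_group_elements_def group_Socle_def)

end

context rank_one_hopf_algebra
begin

lemma span_group_iff:
  assumes "L \<subseteq> carrier G"
  shows "u \<in> span (\<iota> ` L) \<longleftrightarrow>
    (\<forall>g\<in>carrier G. \<forall>m<n. coord g m u \<noteq> 0 \<longrightarrow> g \<in> L \<and> m = 0)"
proof
  assume "u \<in> span (\<iota> ` L)"
  then show "\<forall>g\<in>carrier G. \<forall>m<n. coord g m u \<noteq> 0 \<longrightarrow> g \<in> L \<and> m = 0"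
  proof (induction rule: span_induct_alt)
    case (step c v w)
    then obtain h where "v = \<iota> h" "h \<in> L"
      by blast
    with step assms show ?case
      by (auto simp: coord_emb split: if_splits)
  qed simp
next
  assume *: "\<forall>g\<in>carrier G. \<forall>m<n. coord g m u \<noteq> 0 \<longrightarrow> g \<in> L \<and> m = 0"
  have "scale (coord g m u) (\<iota> g * x ^ m) \<in> span (\<iota> ` L)" if "g \<in> carrier G" "m < n" for g m
  proof (cases "coord g m u = 0")
    case False
    with * that have "g \<in> L" "m = 0"
      by blast+
    then show ?thesis
      by (simp add: span_scale span_base)
  qed (simp add: span_zero)
  then have "(\<Sum>g\<in>carrier G. \<Sum>m<n. scale (coord g m u) (\<iota> g * x ^ m)) \<in> span (\<iota> ` L)"
    by (intro span_sum) auto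
  then show "u \<in> span (\<iota> ` L)"
    by (simp add: coord_expansion)
qed

lemma coord_group_mult_power:
  assumes "c \<in> span (\<iota> ` L)" "L \<subseteq> carrier G" "i < n"
  shows "coord g m (c * x ^ i) = (if m = i then coord g 0 c else 0)"
  using assms(1)
proof (induction rule: span_induct_alt)
  case (step e v w)
  then obtain h where "v = \<iota> h" "h \<in> L"
    by blast
  with step assms show ?case
    by (auto simp: coord_basis coord_emb distrib_right scale_mult_left)
qed simp

lemma direct_sum_powers:
  assumes L: "L \<subseteq> carrier G"
  shows "is_internal_direct_sum {u. \<forall>g\<in>carrier G. \<forall>m<n. coord g m u \<noteq> 0 \<longrightarrow> g \<in> L} {..<n}
    (\<lambda>i. {c * x ^ i | c. c \<in> span (\<iota> ` L)})"
  unfolding is_internal_direct_sum_def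
proof (intro conjI allI impI)
  let ?A = "\<lambda>i. {c * x ^ i | c. c \<in> span (\<iota> ` L)}"
  have coord_A: "coord g m v = 0" if "v \<in> ?A i" "i < n" "m \<noteq> i \<or> g \<in> carrier G - L" for v g m i
    using that coord_group_mult_power[OF _ L] n_gt_1 span_group_iff[OF L] by fastforce
  show "{u. \<forall>g\<in>carrier G. \<forall>m<n. coord g m u \<noteq> 0 \<longrightarrow> g \<in> L}
      = {\<Sum>i\<in>{..<n}. f i | f. \<forall>i\<in>{..<n}. f i \<in> ?A i}" (is "?U = ?V")
  proof (intro equalityI subsetI)
    fix u assume u: "u \<in> ?U"
    define c where "c i = (\<Sum>g\<in>carrier G. scale (coord g i u) (\<iota> g))" for i
    have "c i \<in> span (\<iota> ` L)" if "i < n" for i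
      unfolding c_def
    proof (rule span_sum)
      fix g assume "g \<in> carrier G"
      with u that show "scale (coord g i u) (\<iota> g) \<in> span (\<iota> ` L)"
        by (cases "coord g i u = 0") (simp_all add: span_zero span_scale span_base)
    qed
    moreover have "(\<Sum>i\<in>{..<n}. c i * x ^ i) = u"
    proof -
      have "(\<Sum>i\<in>{..<n}. c i * x ^ i) = (\<Sum>i<n. \<Sum>g\<in>carrier G. scale (coord g i u) (\<iota> g * x ^ i))"
        by (simp add: c_def sum_distrib_right scale_mult_left)
      also have "\<dots> = u"
        by (subst sum.swap) (rule coord_expansion)
      finally show ?thesis .
    qed
    ultimately show "u \<in> ?V"
      by (auto intro!: exI[of _ "\<lambda>i. c i * x ^ i"])
  next
    fix u assume "u \<in> ?V"
    then obtain f where f: "u = (\<Sum>i\<in>{..<n}. f i)" "\<forall>i\<in>{..<n}. f i \<in> ?A i"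
      by blast
    have "coord g m u = 0" if "g \<in> carrier G - L" for g m
      unfolding f(1) coord_sum
    proof (intro sum.neutral ballI)
      fix i assume "i \<in> {..<n}"
      with f(2) that show "coord g m (f i) = 0"
        using coord_A[of "f i" i m g] by blast
    qed
    then show "u \<in> ?U"
      by blast
  qed
  fix f assume f: "(\<forall>i\<in>{..<n}. f i \<in> ?A i) \<and> (\<Sum>i\<in>{..<n}. f i) = 0"
  show "\<forall>i\<in>{..<n}. f i = 0"
  proof
    fix i assume i: "i \<in> {..<n}"
    show "f i = 0"
    proof (rule coord_eqI)
      fix g m
      assume m: "m < n"
      have "coord g m (f j) = 0" if "j < n" "m \<noteq> j" for j
        using coord_A[of "f j" j m g] that f by blast
      then have "(\<Sum>j\<in>{..<n}. coord g m (f j)) = (\<Sum>j\<in>{..<n}. if m = j then coord g m (f m) else 0)"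
        by (intro sum.cong refl) auto
      then have "coord g m (f m) = coord g m (\<Sum>j\<in>{..<n}. f j)"
        using m by (simp add: coord_sum)
      with f have "coord g m (f m) = 0"
        by simp
      with \<open>\<And>j. j < n \<Longrightarrow> m \<noteq> j \<Longrightarrow> coord g m (f j) = 0\<close> i show "coord g m (f i) = coord g m 0"
        by (cases "m = i") auto
    qed
  qed
qed

end

theorem mainTheorem6:
  fixes G :: "('g, 'm) monoid_scheme"
    and \<chi> lam \<xi> :: "'g \<Rightarrow> 'k::{alg_closed_field, field_char_0}"
    and a :: 'g
    and \<alpha> :: 'k
    and n :: nat
    and scale :: "'k \<Rightarrow> 'h::ring_1 \<Rightarrow> 'h"
    and \<Delta> :: "'h \<Rightarrow> ('h \<times> 'h) list"
    and \<epsilon> :: "'h \<Rightarrow> 'k"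
    and S :: "'h \<Rightarrow> 'h"
    and \<iota> :: "'g \<Rightarrow> 'h"
    and x :: 'h
    and p d :: "'h \<Rightarrow> 'h \<Rightarrow> 'h"
    and L :: "'g set"
    and kL :: "'h set"
  assumes "rank_one_datum G \<chi> a \<alpha>"
    and "n = mult_order (\<chi> a)"
    and "rank_one_hopf_algebra scale \<Delta> \<epsilon> S G \<chi> a \<alpha> \<iota> x"
    and "hopf_q_brace scale \<Delta> \<epsilon> S p d"
    and "p x x = 0" and "d x x = 0"
    and "group_character G lam" and "\<forall>g \<in> carrier G. p x (\<iota> g) = scale (lam g) x"
    and "group_character G \<xi>" and "\<forall>g \<in> carrier G. d x (\<iota> g) = scale (\<xi> g) x"
    and "L = {h \<in> group_Socle G \<iota> p d. lam h = 1 \<and> \<xi> h = 1}"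
    and "kL = module.span scale (\<iota> ` L)"
  shows "(lam a = 1 \<longrightarrow>
           is_internal_direct_sum (Socle scale \<Delta> p d) {..<n} (\<lambda>i. {c * x ^ i | c. c \<in> kL})) \<and>
         (lam a \<noteq> 1 \<longrightarrow> Socle scale \<Delta> p d = kL)"
proof -
  interpret rank_one_hopf_algebra scale \<Delta> \<epsilon> S G \<chi> a \<alpha> \<iota> x
    by fact
  interpret brace: hopf_q_brace scale \<Delta> \<epsilon> S p d
    by fact
  interpret rank_one_actions scale \<Delta> \<epsilon> S G \<chi> a \<alpha> \<iota> x p d lam \<xi>
  proof unfold_locales
    fix h k l
    show "p h (k * l) = p (p h l) k" and "d h (k * l) = d (d h l) k"
      by (fact brace.p_mult brace.d_mult)+
  qed (use assms in \<open>auto intro: brace.p_bilinear brace.d_bilinear brace.counit_p brace.counit_d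
      brace.sweedler_p brace.sweedler_d brace.q_exchange brace.p_one brace.d_one
      brace.mult_p brace.mult_d\<close>)
  have L: "L = trivial_group_elements"
    using assms(11) by (simp add: trivial_group_elements_def)
  note L_carrier = trivial_group_elements_carrier[folded L]
  show ?thesis
  proof (intro conjI impI)
    assume "lam a = 1"
    then have "Socle scale \<Delta> p d = {u. \<forall>g\<in>carrier G. \<forall>m<n. coord g m u \<noteq> 0 \<longrightarrow> g \<in> L}"
      by (auto simp: socle_iff L assms(2))
    then show "is_internal_direct_sum (Socle scale \<Delta> p d) {..<n} (\<lambda>i. {c * x ^ i | c. c \<in> kL})"
      using direct_sum_powers[OF L_carrier] unfolding assms(2,12) by simp
  next
    assume "lam a \<noteq> 1"
    then show "Socle scale \<Delta> p d = kL"
      using span_group_iff[OF L_carrier] unfolding assms(12) by (auto simp: socle_iff L)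
  qed
qed

end
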